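(* For every integer $e\geq 3$ there exists an integer $M$ such that $\mathscr{R}(e,m)<\mathscr{C}(e,m)$ for all integers $m\geq M$.
   Context: A numerical monoid is an additive submonoid $\Gamma\subseteq\mathbb{N}$ (containing $0$) with $\mathbb{N}\setminus\Gamma$ finite. It has a unique minimal set of generators $g_0<g_1<\cdots<g_e$; its embedding dimension is $\mathrm{edim}(\Gamma)=e+1$ and its multiplicity is $\mathrm{mult}(\Gamma)=g_0$. Let $\varphi:\mathbb{N}^{e+1}\to\mathbb{N}$, $\varphi(a_0,\dots,a_e)=\sum_i a_ig_i$, and let $\ker\varphi=\{(\mathbf a,\mathbf b): \varphi(\mathbf a)=\varphi(\mathbf b)\}$ (a congruence on $\mathbb{N}^{e+1}$). The number of minimal relations $\rho(\Gamma)$ is the cardinality of a minimal generating set of the congruence $\ker\varphi$ (independent of the choice). Define $\mathscr{R}(e,m)=\max\{\rho(\Gamma): \mathrm{edim}(\Gamma)=e+1,\ \mathrm{mult}(\Gamma)=m\}$. For positive integers $n,d$ write the Macaulay expansion $n=\binom{n_d}{d}+\cdots+\binom{n_j}{j}$ with uniquely determined integers $n_d>n_{d-1}>\cdots>n_j\geq j\geq 1$, and set $n^{\langle d\rangle}=\binom{n_d+1}{d+1}+\cdots+\binom{n_j+1}{j+1}$; set $0^{\langle d\rangle}=0$. For integers $1<e<m$, let $r$ be the unique integer with $\binom{e+r-1}{r-1}\leq m<\binom{e+r}{r}$, let $s=m-\binom{e+r-1}{r-1}$, and define $\mathscr{C}(e,m)=\binom{e+r-1}{r}+s^{\langle r\rangle}-s$.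 *)

theory Defs
  imports Complex_Main
begin

section \<open>Numerical monoids\<close>

definition add_submonoid :: "nat set \<Rightarrow> bool" where
  "add_submonoid H \<longleftrightarrow> 0 \<in> H \<and> (\<forall>x\<in>H. \<forall>y\<in>H. x + y \<in> H)"

definition numerical_monoid :: "nat set \<Rightarrow> bool" where
  "numerical_monoid \<Gamma> \<longleftrightarrow> add_submonoid \<Gamma> \<and> finite (UNIV - \<Gamma>)"

definition minimal_generating_set :: "nat set \<Rightarrow> nat set \<Rightarrow> bool" where
  "minimal_generating_set \<Gamma> G \<longleftrightarrow>
     add_submonoid hull G = \<Gamma> \<and> (\<forall>G'. G' \<subset> G \<longrightarrow> add_submonoid hull G' \<noteq> \<Gamma>)"

definition min_gens :: "nat set \<Rightarrow> nat set" where
  "min_gens \<Gamma> = (THE G. minimal_generating_set \<Gamma> G)"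

definition nm_edim :: "nat set \<Rightarrow> nat" where
  "nm_edim \<Gamma> = card (min_gens \<Gamma>)"

definition nm_mult :: "nat set \<Rightarrow> nat" where
  "nm_mult \<Gamma> = Min (min_gens \<Gamma>)"

definition gen :: "nat set \<Rightarrow> nat \<Rightarrow> nat" where
  "gen \<Gamma> i = sorted_list_of_set (min_gens \<Gamma>) ! i"


section \<open>Minimal relations\<close>

text \<open>
  A vector in $\mathbb{N}^n$ with coordinates $0,\dots,n-1$ is a function that vanishes from
  index \<open>n\<close> on, so that distinct functions in the carrier are distinct vectors and the sum of
  two vectors is again in the carrier.
\<close>

definition nat_vecs :: "nat \<Rightarrow> (nat \<Rightarrow> nat) set" where
  "nat_vecs n = {a. \<forall>i\<ge>n. a i = 0}"

definition vec_congruence :: "nat \<Rightarrow> ((nat \<Rightarrow> nat) \<times> (nat \<Rightarrow> nat)) set \<Rightarrow> bool" where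
  "vec_congruence n R \<longleftrightarrow>
     equiv (nat_vecs n) R \<and>
     (\<forall>(a, b)\<in>R. \<forall>c\<in>nat_vecs n. (\<lambda>i. a i + c i, \<lambda>i. b i + c i) \<in> R)"

definition fact_hom :: "nat set \<Rightarrow> (nat \<Rightarrow> nat) \<Rightarrow> nat" where
  "fact_hom \<Gamma> a = (\<Sum>i<nm_edim \<Gamma>. a i * gen \<Gamma> i)"

definition fact_ker :: "nat set \<Rightarrow> ((nat \<Rightarrow> nat) \<times> (nat \<Rightarrow> nat)) set" where
  "fact_ker \<Gamma> = {(a, b). a \<in> nat_vecs (nm_edim \<Gamma>) \<and> b \<in> nat_vecs (nm_edim \<Gamma>) \<and>
                        fact_hom \<Gamma> a = fact_hom \<Gamma> b}"

definition minimal_presentation ::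
    "nat set \<Rightarrow> ((nat \<Rightarrow> nat) \<times> (nat \<Rightarrow> nat)) set \<Rightarrow> bool" where
  "minimal_presentation \<Gamma> S \<longleftrightarrow>
     vec_congruence (nm_edim \<Gamma>) hull S = fact_ker \<Gamma> \<and>
     (\<forall>S'. S' \<subset> S \<longrightarrow> vec_congruence (nm_edim \<Gamma>) hull S' \<noteq> fact_ker \<Gamma>)"

text \<open>
  The kernel congruence is finitely generated (Redei), so every minimal presentation is finite;
  all of them have the same cardinality, so the choice below is immaterial.
\<close>

definition num_min_relations :: "nat set \<Rightarrow> nat" where
  "num_min_relations \<Gamma> = card (SOME S. minimal_presentation \<Gamma> S)"

text \<open>
  The set of values is bounded, and it is nonempty whenever \<open>1 \<le> e < m\<close>.
\<close>

definition max_relations :: "nat \<Rightarrow> nat \<Rightarrow> nat" where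
  "max_relations e m =
     Max {num_min_relations \<Gamma> | \<Gamma>.
            numerical_monoid \<Gamma> \<and> nm_edim \<Gamma> = e + 1 \<and> nm_mult \<Gamma> = m}"


section \<open>Macaulay expansions\<close>

definition macaulay_expansion :: "nat \<Rightarrow> nat \<Rightarrow> nat \<Rightarrow> (nat \<Rightarrow> nat) \<Rightarrow> bool" where
  "macaulay_expansion n d j f \<longleftrightarrow>
     1 \<le> j \<and> j \<le> d \<and> j \<le> f j \<and> strict_mono_on {j..d} f \<and>
     n = (\<Sum>i=j..d. f i choose i)"

text \<open>
  For \<open>n, d \<ge> 1\<close>, the index \<open>j\<close> and the values of \<open>f\<close> on \<open>{j..d}\<close> are uniquely determined.
\<close>

definition macaulay_up :: "nat \<Rightarrow> nat \<Rightarrow> nat" where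
  "macaulay_up n d =
     (if n = 0 then 0
      else THE k. \<exists>j f. macaulay_expansion n d j f \<and>
                        k = (\<Sum>i=j..d. (f i + 1) choose (i + 1)))"

definition macaulay_index :: "nat \<Rightarrow> nat \<Rightarrow> nat" where
  "macaulay_index e m =
     (THE r. 1 \<le> r \<and> (e + r - 1) choose (r - 1) \<le> m \<and> m < (e + r) choose r)"

definition relation_bound :: "nat \<Rightarrow> nat \<Rightarrow> int" where
  "relation_bound e m =
     (let r = macaulay_index e m;
          s = m - ((e + r - 1) choose (r - 1))
      in int ((e + r - 1) choose r) + int (macaulay_up s r) - int s)"

end

theory Submission
  imports Defs "HOL-Library.Fun_Lexorder"
begin

text \<open>
  Let $g_0 = m$, and choose in every residue class modulo $m$ the vector of $\mathbb{N}^e$ whose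
  image under $g_1, \dots, g_e$ is smallest, with ties broken by a monomial order. These at most
  $m$ vectors form an order ideal $B$, and reducing the minimal elements of the complement of $B$
  (its corners) generates the kernel congruence, so $\rho(\Gamma)$ is at most the number of corners.
  Double counting bounds that number by $1 + (e - 1) \sum_{b \in B} 1 / (|b| + 1)$. For
  $|B| = m$ this is largest when $B$ fills up the degrees from below, and for the full simplex
  $|b| < r$ it equals $\binom{e+r-1}{r} \le \mathscr{C}(e,m)$. However, $B$ is mapped injectively to
  $\mathbb{Z}/m$, and translates of a simplex by a lattice cannot fill space with density close
  to $1$: hence $B$ misses an element $p$ of degree at most $(1 - \delta) r$ together with the cone
  $p + \mathbb{N}^e$. This loses a multiple of $r^{e-1}$, whereas filling an incomplete top degree
  gains only $O(r^{e-2})$.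
\<close>

section \<open>Order ideals of vectors and their corners\<close>

text \<open>Why translates of a simplex \<open>T\<close> pack badly: only the differences of its
  points matter, so the symmetric body \<open>(T - T)/2\<close>, which has the same differences,
  packs just as well, and in dimension at least 2 its volume exceeds that of \<open>T\<close>. A
  cross-polytope inside it already has the volume of \<open>T\<close>; one small simplex outside the
  cross-polytope, of volume \<open>8^-e\<close> times that of \<open>T\<close>, is the explicit
  surplus that determines \<delta>. The orders of magnitude: the cone at \<open>p\<close>, cut off
  at a height proportional to \<open>r\<close>, has about \<open>r^e\<close> points, each weighing
  order \<open>1/r\<close> more than a point of degree \<open>r\<close>. An incomplete top degree
  has \<open>O(r^(e-1))\<close> points of weight about \<open>1/r\<close> each. A separate obstacle
  is that \<open>num_min_relations\<close> counts an arbitrary inclusion-minimal presentation, while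
  the corners give merely some finite one. Comparing the two sizes needs an exchange
  argument.\<close>

definition vecs :: "nat set \<Rightarrow> (nat \<Rightarrow> nat) set" where
  "vecs I = {a. \<forall>i. i \<notin> I \<longrightarrow> a i = 0}"

definition simplex :: "nat set \<Rightarrow> nat \<Rightarrow> (nat \<Rightarrow> nat) set" where
  "simplex I k = {a \<in> vecs I. sum a I \<le> k}"

section \<open>Lattice points of a simplex\<close>

lemma simplex_insert_bij:
  assumes "finite I" "i \<notin> I"
  shows "bij_betw (\<lambda>(j, a). a(i := j)) (SIGMA j:{..k}. simplex I (k - j)) (simplex (insert i I) k)"
proof (rule bij_betw_byWitness[where f' = "\<lambda>a. (a i, a(i := 0))"])
  have eq: "sum (a(i := j)) I = sum a I" for a :: "nat \<Rightarrow> nat" and j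
    using assms by (intro sum.cong) auto
  show "\<forall>x\<in>SIGMA j:{..k}. simplex I (k - j).
      (\<lambda>a. (a i, a(i := 0))) ((\<lambda>(j, a). a(i := j)) x) = x"
    using assms by (auto simp: simplex_def vecs_def fun_eq_iff)
  show "\<forall>a\<in>simplex (insert i I) k. (\<lambda>(j, a). a(i := j)) (a i, a(i := 0)) = a"
    by auto
  show "(\<lambda>(j, a). a(i := j)) ` (SIGMA j:{..k}. simplex I (k - j)) \<subseteq> simplex (insert i I) k"
    using assms by (auto simp: simplex_def vecs_def eq simp del: fun_upd_apply) (auto)
  show "(\<lambda>a. (a i, a(i := 0))) ` simplex (insert i I) k \<subseteq> (SIGMA j:{..k}. simplex I (k - j))"
    using assms by (auto simp: simplex_def vecs_def eq simp del: fun_upd_apply) (auto)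
qed

lemma simplex_card:
  assumes "finite I"
  shows "finite (simplex I k) \<and> card (simplex I k) = (k + card I) choose card I"
  using assms
proof (induction I arbitrary: k rule: finite_induct)
  case empty
  have "simplex {} k = {\<lambda>_. 0}" by (auto simp: simplex_def vecs_def)
  then show ?case by simp
next
  case (insert i I)
  note bij = simplex_insert_bij[OF insert.hyps, of k]
  have "finite (SIGMA j:{..k}. simplex I (k - j))" using insert.IH by auto
  then have fin: "finite (simplex (insert i I) k)" using bij bij_betw_finite by blast
  have "card (simplex (insert i I) k) = card (SIGMA j:{..k}. simplex I (k - j))"
    using bij by (simp add: bij_betw_same_card)
  also have "\<dots> = (\<Sum>j\<le>k. (k - j + card I) choose card I)"
    using insert.IH by (subst card_SigmaI) auto
  also have "\<dots> = (\<Sum>j\<le>k. (card I + j) choose card I)"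
    by (rule sum.reindex_bij_witness[of _ "\<lambda>j. k - j" "\<lambda>j. k - j"]) (auto simp: add.commute)
  also have "\<dots> = (card I + k + 1) choose (card I + 1)" by (rule choose_rising_sum(1))
  finally show ?case using fin insert.hyps by (simp add: add.commute)
qed

section \<open>Counting corners by weights\<close>

definition corners :: "nat set \<Rightarrow> (nat \<Rightarrow> nat) set \<Rightarrow> (nat \<Rightarrow> nat) set" where
  "corners I B = {c \<in> vecs I - B. \<forall>i\<in>I. c i > 0 \<longrightarrow> c(i := c i - 1) \<in> B}"

lemma vecs_zero_iff: "a \<in> vecs I \<Longrightarrow> a = (\<lambda>_. 0) \<longleftrightarrow> (\<forall>i\<in>I. a i = 0)"
  by (auto simp: vecs_def fun_eq_iff)

lemma finite_corners:
  assumes "finite I" "finite B" "(\<lambda>_. 0) \<in> B"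
  shows "finite (corners I B)"
proof -
  have "corners I B \<subseteq> (\<lambda>(b, i). b(i := Suc (b i))) ` (B \<times> I)"
  proof
    fix c assume c: "c \<in> corners I B"
    then have "c \<in> vecs I" "c \<noteq> (\<lambda>_. 0)" using assms(3) by (auto simp: corners_def)
    then obtain i where i: "i \<in> I" "c i > 0" using vecs_zero_iff[of c I] by auto
    then have "c(i := c i - 1) \<in> B" using c by (auto simp: corners_def)
    then show "c \<in> (\<lambda>(b, i). b(i := Suc (b i))) ` (B \<times> I)"
      using i by (intro image_eqI[of _ _ "(c(i := c i - 1), i)"]) auto
  qed
  then show ?thesis using assms finite_subset by blast
qed

text \<open>Each nonzero vector \<open>c\<close> distributes weight \<open>c i / |c|\<close> to its predecessor in direction
  \<open>i\<close>; a vector \<open>b\<close> of \<open>B\<close> receives at most \<open>(|b| + card I) / (|b| + 1)\<close> in total.\<close>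

lemma card_corners_le:
  assumes "finite I" "finite B" "B \<subseteq> vecs I" "(\<lambda>_. 0) \<in> B"
    and down: "\<And>a i. a \<in> B \<Longrightarrow> i \<in> I \<Longrightarrow> a i > 0 \<Longrightarrow> a(i := a i - 1) \<in> B"
  shows "real (card (corners I B)) \<le> 1 + (real (card I) - 1) * (\<Sum>b\<in>B. 1 / (real (sum b I) + 1))"
proof -
  \<comment> \<open>The zero vector has no predecessor that could receive its weight, so it is left
    out; this is the origin of the summand 1 in the bound.\<close>
  define C where "C = (corners I B \<union> B) - {\<lambda>_. 0}"
  define W where "W = (SIGMA c:C. {i\<in>I. c i > 0})"
  define p where "p = (\<lambda>(c::nat \<Rightarrow> nat, i::nat). (c(i := c i - 1), i))"
  have finC: "finite C" using finite_corners[OF assms(1,2,4)] assms(2) by (simp add: C_def)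
  have CV: "C \<subseteq> vecs I" using assms(3) by (auto simp: C_def corners_def)
  have upd: "sum c I = Suc (sum (c(i := c i - 1)) I)" if "i \<in> I" "c i > 0" for c :: "nat \<Rightarrow> nat"
    and i
  proof -
    have "sum (c(i := c i - 1)) (I - {i}) = sum c (I - {i})" by (intro sum.cong) auto
    then show ?thesis
      using that assms(1) sum.remove[of I i c] sum.remove[of I i "c(i := c i - 1)"] by simp
  qed
  have unit: "(\<Sum>i\<in>{i\<in>I. c i > 0}. real (c i) / real (sum c I)) = 1" if "c \<in> C" for c
  proof -
    have "c \<in> vecs I" "c \<noteq> (\<lambda>_. 0)" using that CV by (auto simp: C_def)
    then have "sum c I \<noteq> 0" using vecs_zero_iff[of c I] assms(1) by auto
    have "(\<Sum>i\<in>{i\<in>I. c i > 0}. real (c i) / real (sum c I)) = (\<Sum>i\<in>I. real (c i) / real (sum c I))"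
      using assms(1) by (intro sum.mono_neutral_left) auto
    also have "\<dots> = 1" using \<open>sum c I \<noteq> 0\<close>
      by (simp add: sum_divide_distrib[symmetric] flip: of_nat_sum)
    finally show ?thesis .
  qed
  have inj: "inj_on p W"
  proof (rule inj_onI)
    fix x y assume "x \<in> W" "y \<in> W" "p x = p y"
    then obtain c d i where xy: "x = (c, i)" "y = (d, i)" "c i > 0" "d i > 0"
      and eq: "c(i := c i - 1) = d(i := d i - 1)"
      by (auto simp: p_def W_def)
    have "c j = d j" for j
      using fun_cong[OF eq, of j] xy(3,4) by (cases "j = i") auto
    then show "x = y" using xy by auto
  qed
  have sub: "p ` W \<subseteq> B \<times> I"
    using down by (auto simp: p_def W_def C_def corners_def)
  have "real (card C) = (\<Sum>c\<in>C. \<Sum>i\<in>{i\<in>I. c i > 0}. real (c i) / real (sum c I))"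
    using unit by simp
  also have "\<dots> = (\<Sum>(c, i)\<in>W. real (c i) / real (sum c I))"
    unfolding W_def using finC assms(1) by (intro sum.Sigma) auto
  also have "\<dots> = (\<Sum>x\<in>W. (\<lambda>(b, i). (real (b i) + 1) / (real (sum b I) + 1)) (p x))"
  proof (intro sum.cong refl)
    fix x assume "x \<in> W"
    then obtain c i where x: "x = (c, i)" and i: "i \<in> I" "c i > 0" by (auto simp: W_def)
    have "real (sum c I) = real (sum (c(i := c i - 1)) I) + 1" using upd[of i c] i by linarith
    then show "(case x of (c, i) \<Rightarrow> real (c i) / real (sum c I)) =
        (\<lambda>(b, i). (real (b i) + 1) / (real (sum b I) + 1)) (p x)"
      using i by (simp add: x p_def of_nat_diff del: of_nat_sum)
  qed
  also have "\<dots> = (\<Sum>(b, i)\<in>p ` W. (real (b i) + 1) / (real (sum b I) + 1))"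
    using inj by (simp add: sum.reindex)
  also have "\<dots> \<le> (\<Sum>(b, i)\<in>B \<times> I. (real (b i) + 1) / (real (sum b I) + 1))"
    using sub assms
    by (intro sum_mono2) (auto intro!: divide_nonneg_nonneg add_nonneg_nonneg sum_nonneg)
  also have "\<dots> = (\<Sum>b\<in>B. \<Sum>i\<in>I. (real (b i) + 1) / (real (sum b I) + 1))"
    by (simp add: sum.cartesian_product)
  also have "\<dots> = (\<Sum>b\<in>B. 1 + (real (card I) - 1) * (1 / (real (sum b I) + 1)))"
  proof (intro sum.cong refl)
    fix b
    have "real (sum b I) + 1 \<noteq> 0" by (simp add: add_nonneg_eq_0_iff sum_nonneg)
    moreover have "(\<Sum>i\<in>I. real (b i) + 1) = real (sum b I) + real (card I)"
      by (simp add: sum.distrib)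
    ultimately show "(\<Sum>i\<in>I. (real (b i) + 1) / (real (sum b I) + 1)) =
        1 + (real (card I) - 1) * (1 / (real (sum b I) + 1))"
      by (simp add: sum_divide_distrib[symmetric] field_simps del: of_nat_sum)
  qed
  also have "\<dots> = real (card B) + (real (card I) - 1) * (\<Sum>b\<in>B. 1 / (real (sum b I) + 1))"
    by (simp add: sum.distrib sum_distrib_left)
  finally have 1: "real (card C) \<le> real (card B) + (real (card I) - 1) * (\<Sum>b\<in>B. 1 / (real (sum b I) + 1))" .
  have "card (corners I B \<union> B) = card (corners I B) + card B"
    using finite_corners[OF assms(1,2,4)] assms(2)
      by (intro card_Un_disjoint) (auto simp: corners_def)
  moreover have "card C + 1 = card (corners I B \<union> B)"
    using finite_corners[OF assms(1,2,4)] assms(2,4) unfolding C_def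
      by (metis Suc_eq_plus1 UnI2 card_Suc_Diff1 finite_UnI)
  ultimately show ?thesis using 1 by linarith
qed

text \<open>Truncated subtraction would make \<open>simplex I (r - 1)\<close> nonempty for
  \<open>r = 0\<close>. The strict bound gives the empty set there, which is where the weight
  identity starts its induction.\<close>

definition open_simplex :: "nat set \<Rightarrow> nat \<Rightarrow> (nat \<Rightarrow> nat) set" where
  "open_simplex I r = {a \<in> vecs I. sum a I < r}"

lemma open_simplex_Suc: "open_simplex I (Suc r) = simplex I r"
  by (auto simp: open_simplex_def simplex_def)

lemma open_simplex_card:
  assumes "finite I" "card I = Suc n"
  shows "finite (open_simplex I r) \<and> card (open_simplex I r) = (r + n) choose Suc n"
proof (cases r)
  case 0
  then show ?thesis by (simp add: open_simplex_def)
next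
  case (Suc k)
  then show ?thesis using simplex_card[OF assms(1), of k] assms(2) by (simp add: open_simplex_Suc)
qed

text \<open>The layer of degree \<open>r\<close> has C(n+r, r) points of weight 1/(r+1); absorption
  turns \<open>n\<close> times their total into C(n+r, r+1), so the induction step is Pascal's rule.
  For \<open>r > 0\<close> the right-hand side counts the vectors of degree \<open>r\<close>, which
  are the corners of this order ideal: the bound of \<open>card_corners_le\<close> is
  attained.\<close>

lemma open_simplex_weight:
  assumes "finite I" "card I = Suc n"
  shows "1 + real n * (\<Sum>b\<in>open_simplex I r. 1 / (real (sum b I) + 1)) = real ((n + r) choose r)"
proof (induction r)
  case 0
  then show ?case by (simp add: open_simplex_def)
next
  case (Suc r)
  define L where "L = {a \<in> vecs I. sum a I = r}"
  have split: "open_simplex I (Suc r) = open_simplex I r \<union> L" "open_simplex I r \<inter> L = {}"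
    by (auto simp: open_simplex_def L_def)
  note fin = open_simplex_card[OF assms, of r] open_simplex_card[OF assms, of "Suc r"]
  have finL: "finite L" using fin(2) split(1) by simp
  have "card (open_simplex I (Suc r)) = card (open_simplex I r) + card L"
    using split fin finL card_Un_disjoint by metis
  then have "card L = (n + r) choose n" using fin by (simp add: add.commute)
  also have "\<dots> = (n + r) choose r" using binomial_symmetric[of r "n + r"] by simp
  finally have cardL: "card L = (n + r) choose r" .
  have "Suc r * ((n + r) choose Suc r) = n * ((n + r) choose r)"
  proof (cases n)
    case (Suc b)
    then show ?thesis using Suc_times_binomial_add[of r b] by (simp add: add.commute)
  qed simp
  then have absorb: "real n * real ((n + r) choose r) = real (Suc r) * real ((n + r) choose Suc r)"
    by (metis of_nat_mult)
  have "(\<Sum>b\<in>L. 1 / (real (sum b I) + 1)) = real ((n + r) choose r) / (real r + 1)"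
  proof -
    have "(\<Sum>b\<in>L. 1 / (real (sum b I) + 1)) = (\<Sum>b\<in>L. 1 / (real r + 1))"
      by (intro sum.cong) (auto simp: L_def simp del: of_nat_sum)
    then show ?thesis by (simp add: cardL)
  qed
  then have "real n * (\<Sum>b\<in>L. 1 / (real (sum b I) + 1)) =
      real n * real ((n + r) choose r) / (real r + 1)"
    by simp
  also have "\<dots> = real ((n + r) choose Suc r)"
    unfolding absorb by (simp add: add.commute[of 1])
  finally have "real n * (\<Sum>b\<in>L. 1 / (real (sum b I) + 1)) = real ((n + r) choose Suc r)" .
  moreover have "(\<Sum>b\<in>open_simplex I (Suc r). 1 / (real (sum b I) + 1)) =
      (\<Sum>b\<in>open_simplex I r. 1 / (real (sum b I) + 1)) + (\<Sum>b\<in>L. 1 / (real (sum b I) + 1))"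
    using split fin finL by (simp add: sum.union_disjoint)
  ultimately show ?case using Suc.IH by (simp add: distrib_left)
qed

text \<open>Swapping elements of \<open>B\<close> outside the simplex, of weight at most \<open>1 / (r + 1)\<close>, for missing
  elements of the simplex only increases the total weight; the elements of \<open>D\<close> quantify
  the gain.\<close>

lemma weight_less_open_simplex:
  assumes "finite I" "card I = Suc n" "finite B" "B \<subseteq> vecs I"
    and cardB: "card B \<le> card (open_simplex I r) + s"
    and D: "D \<subseteq> open_simplex I r - B" "\<And>a. a \<in> D \<Longrightarrow> sum a I + v \<le> r"
    and gain: "s * (r + 1) < card D * v"
  shows "(\<Sum>b\<in>B. 1 / (real (sum b I) + 1)) < (\<Sum>b\<in>open_simplex I r. 1 / (real (sum b I) + 1))"
proof -
  define f where "f = (\<lambda>b. 1 / (real (sum b I) + 1))"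
  \<comment> \<open>The weight of a point of degree exactly \<open>r\<close>: points of the open
    simplex weigh at least \<open>c\<close>, points outside at most \<open>c\<close>, so both sides
    of a swap are compared with it.\<close>
  define c where "c = 1 / (real r + 1)"
  let ?S = "open_simplex I r"
  have finS: "finite ?S" using open_simplex_card[OF assms(1,2)] by blast
  have finD: "finite D" using D(1) finS finite_subset by blast
  have fB: "f b \<le> c" if "b \<in> B - ?S" for b
  proof -
    have "real r \<le> real (sum b I)" using that assms(4) unfolding open_simplex_def
      by (auto simp del: of_nat_sum)
    then show ?thesis unfolding f_def c_def
      by (intro divide_left_mono mult_pos_pos) (simp_all add: add_nonneg_pos del: of_nat_sum)
  qed
  have fS: "c \<le> f b" if "b \<in> ?S" for b
  proof -
    have "real (sum b I) \<le> real r" using that unfolding open_simplex_def by (simp del: of_nat_sum)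
    then show ?thesis unfolding f_def c_def
      by (intro divide_left_mono mult_pos_pos) (simp_all add: add_nonneg_pos del: of_nat_sum)
  qed
  \<comment> \<open>The difference 1/(x+1) - 1/(r+1) has numerator r - x, at least \<open>v\<close>,
    over a denominator of at most (r+1)^2.\<close>
  have fD: "real v * c * c \<le> f b - c" if "b \<in> D" for b
  proof -
    define x where "x = real (sum b I)"
    have x: "x + real v \<le> real r" "0 \<le> x"
      using D(2)[OF that] unfolding x_def by (simp_all del: of_nat_sum flip: of_nat_add)
    have "real v / ((real r + 1) * (real r + 1)) \<le> (real r - x) / ((x + 1) * (real r + 1))"
      using x by (intro frac_le mult_right_mono) auto
    also have "\<dots> = f b - c"
      using x unfolding f_def c_def x_def[symmetric] by (simp add: field_simps)
    finally show ?thesis by (simp add: c_def)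
  qed
  have "card B = card (B \<inter> ?S) + card (B - ?S)"
    using assms(3) by (metis card_Int_Diff)
  moreover have "card ?S = card (B \<inter> ?S) + card (?S - B)"
    using finS by (metis card_Int_Diff Int_commute)
  ultimately have cards: "card (B - ?S) \<le> card (?S - B) + s" using cardB by linarith
  have "sum f B = sum f (B \<inter> ?S) + sum f (B - ?S)" using assms(3) by (rule sum.Int_Diff)
  also have "sum f (B - ?S) \<le> real (card (B - ?S)) * c" using fB by (rule sum_bounded_above)
  also have "\<dots> \<le> (real (card (?S - B)) + real s) * c"
    using cards by (intro mult_right_mono) (auto simp: c_def)
  finally have 1: "sum f B \<le> sum f (B \<inter> ?S) + (real (card (?S - B)) + real s) * c" by simp
  have "real s * (real r + 1) < real (card D) * real v"
    using gain by (metis of_nat_1 of_nat_add of_nat_less_iff of_nat_mult)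
  then have "real s * (real r + 1) * (c * c) < real (card D) * real v * (c * c)"
    by (intro mult_strict_right_mono) (auto simp: c_def)
  moreover have "real s * (real r + 1) * (c * c) = real s * c" by (simp add: c_def)
  ultimately have "real s * c < real (card D) * (real v * c * c)" by (simp only: mult_ac)
  also have "\<dots> \<le> (\<Sum>b\<in>D. f b - c)" using fD by (intro sum_bounded_below) auto
  also have "\<dots> \<le> (\<Sum>b\<in>?S - B. f b - c)"
    using D(1) finS fS by (intro sum_mono2) auto
  also have "\<dots> = sum f (?S - B) - real (card (?S - B)) * c" by (simp add: sum_subtractf)
  finally have 2: "sum f (?S - B) > (real (card (?S - B)) + real s) * c"
    by (simp add: distrib_right)
  have "sum f ?S = sum f (?S \<inter> B) + sum f (?S - B)" using finS by (rule sum.Int_Diff)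
  then have "sum f B < sum f ?S" using 1 2 by (simp add: Int_commute)
  then show ?thesis by (simp add: f_def)
qed

text \<open>Integer points with a sign pattern \<open>P\<close> whose positive and negative parts are both at most
  half of the simplex: their differences are differences of two simplex points, so
  they too are distinct modulo \<open>m\<close>. Those with absolute sum at most \<open>4 * u\<close>
  already fill asymptotically the volume of the simplex; the last summand counts points
  beyond.\<close>

lemma sign_pattern_packing:
  fixes g :: "nat \<Rightarrow> nat"
  assumes "finite I" "i \<in> I" "j \<in> I" "i \<noteq> j" "m > 0" "u > 0"
    and inj: "inj_on (\<lambda>a. (\<Sum>l\<in>I. a l * g l) mod m) (simplex I (8 * u + card I))"
  shows "2 ^ card I * card (simplex I (4 * u)) + card (simplex I u) \<le> m"
proof -
  \<comment> \<open>Coordinates in \<open>P\<close> are nonnegative, the others negative. The shift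
    by -1 keeps 0 from carrying both signs, so that the integer point determines
    \<open>(P, b)\<close>; it costs the summand \<open>card I\<close> in the size of the
    simplex.\<close>
  define x where "x = (\<lambda>(P, b::nat \<Rightarrow> nat) l. if l \<in> P then int (b l) else - int (b l) - 1)"
  define h where "h = (\<lambda>Pb. (\<Sum>l\<in>I. x Pb l * int (g l)) mod int m)"
  \<comment> \<open>The extra simplex is shifted by 3u in two coordinates that get opposite signs:
    each sign part stays within 3u + u = 4u, while the total is at least 6u and hence outside
    \<open>Q1\<close>.\<close>
  define w where "w = (\<lambda>l. if l = i \<or> l = j then 3 * u else 0)"
  define Q1 where "Q1 = Pow I \<times> simplex I (4 * u)"
  define Q2 where "Q2 = (\<lambda>b. ({i}, \<lambda>l. b l + w l)) ` simplex I u"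
  define Q where "Q = {(P, b). P \<subseteq> I \<and> b \<in> vecs I \<and> sum b P \<le> 4 * u \<and> sum b (I - P) \<le> 4 * u}"
  have sum_sub: "sum b J \<le> sum b I" if "J \<subseteq> I" for b :: "nat \<Rightarrow> nat" and J
    using that assms(1) by (intro sum_mono2) auto
  have Q1: "Q1 \<subseteq> Q"
  proof clarify
    fix P b assume "(P, b) \<in> Q1"
    then show "(P, b) \<in> Q"
      using sum_sub[of P b] sum_sub[of "I - P" b] by (auto simp: Q1_def Q_def simplex_def)
  qed
  have w1: "sum w {i} = 3 * u" and w2: "sum w (I - {i}) = 3 * u"
  proof -
    have "sum w (I - {i}) = sum w {j}"
      using assms by (intro sum.mono_neutral_right) (auto simp: w_def)
    then show "sum w (I - {i}) = 3 * u" by (simp add: w_def)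
  qed (simp add: w_def)
  have Q2: "Q2 \<subseteq> Q"
  proof
    fix y assume "y \<in> Q2"
    then obtain b where b: "b \<in> simplex I u" "y = ({i}, \<lambda>l. b l + w l)" by (auto simp: Q2_def)
    have "(\<lambda>l. b l + w l) \<in> vecs I" using b assms by (auto simp: simplex_def vecs_def w_def)
    moreover have "sum (\<lambda>l. b l + w l) {i} \<le> 4 * u" "sum (\<lambda>l. b l + w l) (I - {i}) \<le> 4 * u"
      using b w1 w2 sum_sub[of "{i}" b] sum_sub[of "I - {i}" b] assms(2)
      unfolding sum.distrib by (auto simp: simplex_def)
    ultimately show "y \<in> Q" using b assms(2) by (simp add: Q_def)
  qed
  have "Q1 \<inter> Q2 = {}"
  proof -
    have False if "b \<in> simplex I u" "(\<lambda>l. b l + w l) \<in> simplex I (4 * u)" for b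
    proof -
      have "sum w I = sum w {i} + sum w (I - {i})" using assms(1,2) by (simp add: sum.remove)
      then have "sum (\<lambda>l. b l + w l) I \<ge> 6 * u" unfolding sum.distrib w1 w2 by simp
      then show False using that(2) \<open>u > 0\<close> by (simp add: simplex_def)
    qed
    then show ?thesis by (auto simp: Q1_def Q2_def)
  qed
  moreover have "finite Q1" "card Q1 = 2 ^ card I * card (simplex I (4 * u))"
    using assms(1) simplex_card[OF assms(1)] by (auto simp: Q1_def card_cartesian_product card_Pow)
  moreover have "finite Q2" "card Q2 = card (simplex I u)"
  proof -
    have "inj (\<lambda>b. ({i}, \<lambda>l. b l + w l))" by (auto simp: inj_def fun_eq_iff)
    then show "card Q2 = card (simplex I u)" unfolding Q2_def
      by (intro card_image) (auto intro: inj_on_subset)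
    show "finite Q2" using simplex_card[OF assms(1)] by (simp add: Q2_def)
  qed
  ultimately have cardQ: "card (Q1 \<union> Q2) = 2 ^ card I * card (simplex I (4 * u)) + card (simplex I u)"
    by (simp add: card_Un_disjoint)
  \<comment> \<open>The positive part of the difference of two points; \<open>p z y\<close> is the
    negative part of the same difference.\<close>
  define p where "p = (\<lambda>y z l. if l \<in> I then nat (x y l - x z l) else 0)"
  have psimplex: "p y z \<in> simplex I (8 * u + card I)" if yz: "y \<in> Q" "z \<in> Q" for y z
  proof -
    obtain P b P' b' where eq: "y = (P, b)" "z = (P', b')" by fastforce
    have "sum (p y z) I \<le> (\<Sum>l\<in>I. (if l \<in> P then b l else 0) + (if l \<in> I - P' then b' l else 0) + 1)"
      by (intro sum_mono) (auto simp: p_def eq x_def)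
    also have "\<dots> = sum b P + sum b' (I - P') + card I"
    proof -
      have "(\<Sum>l\<in>I. if l \<in> J then b l else 0) = sum b J" if "J \<subseteq> I" for J and b :: "nat \<Rightarrow> nat"
        using that assms(1) by (simp add: sum.inter_restrict[symmetric] Int_absorb1)
      from this[of P b] this[of "I - P'" b'] show ?thesis
        using yz eq by (simp only: sum.distrib) (auto simp: Q_def)
    qed
    finally show ?thesis using yz by (auto simp: simplex_def vecs_def p_def Q_def eq)
  qed
  have "inj_on h Q"
  proof (rule inj_onI)
    fix y z assume yz: "y \<in> Q" "z \<in> Q" "h y = h z"
    obtain P b P' b' where eq: "y = (P, b)" "z = (P', b')" by fastforce
    have "int (\<Sum>l\<in>I. p y z l * g l) - int (\<Sum>l\<in>I. p z y l * g l) =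
        (\<Sum>l\<in>I. (x y l - x z l) * int (g l))"
      unfolding of_nat_sum sum_subtractf[symmetric]
      by (intro sum.cong) (auto simp: p_def algebra_simps)
    also have "\<dots> = (\<Sum>l\<in>I. x y l * int (g l)) - (\<Sum>l\<in>I. x z l * int (g l))"
      by (simp add: algebra_simps sum_subtractf)
    finally have "int m dvd int (\<Sum>l\<in>I. p y z l * g l) - int (\<Sum>l\<in>I. p z y l * g l)"
      using yz(3) by (simp add: h_def mod_eq_dvd_iff)
    then have "(\<Sum>l\<in>I. p y z l * g l) mod m = (\<Sum>l\<in>I. p z y l * g l) mod m"
      by (metis mod_eq_dvd_iff of_nat_eq_iff zmod_int)
    \<comment> \<open>For congruent points the two parts of the difference are congruent simplex
      points, hence equal. Their supports are disjoint, so both vanish.\<close>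
    then have pp: "p y z = p z y"
      using inj_onD[OF inj] psimplex yz(1,2) by blast
    have xx: "x y l = x z l" if "l \<in> I" for l
      using fun_cong[OF pp, of l] that by (auto simp: p_def)
    have mem: "l \<in> P \<longleftrightarrow> l \<in> P'" and val: "b l = b' l" if "l \<in> I" for l
      using xx[OF that] by (auto simp: x_def eq split: if_splits)
    have "P = P'" using mem yz eq by (auto simp: Q_def)
    moreover have "b = b'"
    proof
      fix l show "b l = b' l" using val yz eq by (cases "l \<in> I") (auto simp: Q_def vecs_def)
    qed
    ultimately show "y = z" by (simp add: eq)
  qed
  then have "inj_on h (Q1 \<union> Q2)" using Q1 Q2 by (auto intro: inj_on_subset)
  moreover have "h ` (Q1 \<union> Q2) \<subseteq> {0..<int m}" using \<open>m > 0\<close> by (auto simp: h_def)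
  ultimately have "card (Q1 \<union> Q2) \<le> card {0..<int m}" by (intro card_inj_on_le) auto
  then show ?thesis using cardQ by simp
qed

section \<open>From the packing bound to a missing vector of low degree\<close>

lemma pow_le_fact_binomial: "N ^ e \<le> fact e * ((N + e) choose e)"
proof (induction e)
  case (Suc e)
  have "fact (Suc e) * ((N + Suc e) choose Suc e) = fact e * (Suc e * (Suc (N + e) choose Suc e))"
    by (simp only: fact_Suc add_Suc_right mult.assoc mult.commute[of "fact e"] of_nat_id)
  also have "\<dots> = (N + Suc e) * (fact e * ((N + e) choose e))"
    by (simp only: Suc_times_binomial_eq add_Suc_right mult_ac)
  finally show ?case using mult_le_mono[OF _ Suc.IH, of N "N + Suc e"] by simp
qed simp

text \<open>Divided by (8q)^e, the inequality reads (1 + 1/q)^e \<le> 1 + 8^-e: the surplus of the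
  packing pays for enlarging the simplex in the ratio (q + 1)/q.\<close>

lemma ex_ratio_near_one: "\<exists>q\<ge>1. (8 * (q + 1)) ^ e \<le> (8 * q) ^ e + (q::nat) ^ e"
proof -
  have "(\<lambda>q. (1 + inverse (real (Suc q))) ^ e) \<longlonglongrightarrow> (1 + 0) ^ e"
    by (intro tendsto_intros LIMSEQ_inverse_real_of_nat)
  then have "\<forall>\<^sub>F q in sequentially. (1 + inverse (real (Suc q))) ^ e < 1 + 1 / 8 ^ e"
    by (rule order_tendstoD) simp
  then obtain q where q: "(1 + inverse (real (Suc q))) ^ e < 1 + 1 / 8 ^ e"
    by (auto dest: eventually_happens)
  define Q where "Q = real (Suc q)"
  have "Q > 0" by (simp add: Q_def)
  have "(8 * (Q + 1)) ^ e = (8 * Q) ^ e * (1 + inverse Q) ^ e"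
  proof -
    have "8 * (Q + 1) = 8 * Q * (1 + inverse Q)" using \<open>Q > 0\<close> by (simp add: field_simps)
    then show ?thesis by (simp only: power_mult_distrib)
  qed
  also have "\<dots> \<le> (8 * Q) ^ e * (1 + 1 / 8 ^ e)"
    using q \<open>Q > 0\<close> by (intro mult_left_mono) (auto simp: Q_def)
  also have "\<dots> = (8 * Q) ^ e + Q ^ e" by (simp add: field_simps power_mult_distrib)
  finally have "real ((8 * (Suc q + 1)) ^ e) \<le> real ((8 * Suc q) ^ e + Suc q ^ e)"
    unfolding of_nat_power of_nat_add of_nat_mult Q_def by simp
  then show ?thesis unfolding of_nat_le_iff by (intro exI[of _ "Suc q"]) simp
qed

text \<open>With \<open>u = q * v\<close>, the packing bound would make e! m at least (8qv)^e +
  (qv)^e. By the choice of \<open>q\<close> this is at least (8(q+1)v)^e, hence at least (r+e)^e,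
  which contradicts m < C(e+r, r).\<close>

lemma simplex_not_subset:
  fixes g :: "nat \<Rightarrow> nat"
  assumes I: "finite I" "card I = e" "e \<ge> 2"
    and q: "q > 0" "(8 * (q + 1)) ^ e \<le> (8 * q) ^ e + q ^ e"
    and v: "v > 0" "r + e \<le> 8 * (q + 1) * v"
    and m: "0 < m" "m < (e + r) choose r"
    and inj: "inj_on (\<lambda>a. (\<Sum>l\<in>I. a l * g l) mod m) B"
  shows "\<not> simplex I (8 * (q * v) + e) \<subseteq> B"
proof
  assume sub: "simplex I (8 * (q * v) + e) \<subseteq> B"
  obtain i j where ij: "i \<in> I" "j \<in> I" "i \<noteq> j"
    using I card_le_Suc0_iff_eq[OF I(1)] by fastforce
  have "q * v > 0" using q v by simp
  then have "2 ^ e * card (simplex I (4 * (q * v))) + card (simplex I (q * v)) \<le> m"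
    using sign_pattern_packing[OF I(1) ij m(1), of "q * v" g] inj_on_subset[OF inj sub] I by simp
  also note m(2)
  also have "(e + r) choose r = (r + e) choose e"
    using binomial_symmetric[of r "e + r"] by (simp add: add.commute)
  finally have lt: "2 ^ e * ((4 * (q * v) + e) choose e) + ((q * v + e) choose e) < (r + e) choose e"
    using simplex_card[OF I(1)] I(2) by simp
  have "fact e * ((r + e) choose e) \<le> (r + e) ^ e"
    using binomial_fact_pow[of "r + e" e] by (simp add: mult.commute)
  also have "\<dots> \<le> (8 * (q + 1) * v) ^ e" using v by (intro power_mono) auto
  also have "\<dots> \<le> ((8 * q) ^ e + q ^ e) * v ^ e"
    using q by (simp only: power_mult_distrib[of _ v]) (intro mult_right_mono, auto)
  also have "\<dots> = 2 ^ e * (4 * (q * v)) ^ e + (q * v) ^ e"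
  proof -
    have "(8 * q) ^ e * v ^ e = (2 * (4 * (q * v))) ^ e"
      by (simp only: power_mult_distrib[symmetric]) (simp add: mult.assoc)
    then show ?thesis by (simp only: power_mult_distrib distrib_right)
  qed
  also have "\<dots> \<le> 2 ^ e * (fact e * ((4 * (q * v) + e) choose e)) + fact e * ((q * v + e) choose e)"
    by (intro add_mono mult_left_mono pow_le_fact_binomial) auto
  also have "\<dots> = fact e * (2 ^ e * ((4 * (q * v) + e) choose e) + ((q * v + e) choose e))"
    by (simp only: distrib_left mult_ac)
  also have "\<dots> < fact e * ((r + e) choose e)" using lt by simp
  finally show False by simp
qed

text \<open>The number \<open>8 * (q + 1) * v\<close> is the next multiple of
  \<open>8 * (q + 1)\<close> above \<open>r + e\<close>, so the missing \<open>p\<close> has degree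
  about q/(q+1) times \<open>r\<close>. The lower bound on \<open>v\<close> makes the gain
  v^(e+1)/e! from the truncated cone at \<open>p\<close> exceed (r+e)^e, which bounds
  s(r+1).\<close>

lemma card_corners_less:
  fixes g :: "nat \<Rightarrow> nat"
  assumes I: "finite I" "card I = e" "e \<ge> 2"
    and q: "q > 0" "(8 * (q + 1)) ^ e \<le> (8 * q) ^ e + q ^ e"
    and v: "v = (r + e) div (8 * (q + 1)) + 1" "fact e * (8 * (q + 1)) ^ e < v"
    and r: "r > 0" and m: "(e + r - 1) choose (r - 1) \<le> m" "m < (e + r) choose r"
    and B: "finite B" "B \<subseteq> vecs I" "(\<lambda>_. 0) \<in> B" "card B \<le> m"
    and down: "\<And>a b. a \<in> B \<Longrightarrow> b \<le> a \<Longrightarrow> b \<in> B"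
    and inj: "inj_on (\<lambda>a. (\<Sum>l\<in>I. a l * g l) mod m) B"
  shows "card (corners I B) < (e + r - 1) choose r"
proof -
  obtain n where n: "e = Suc n" "n \<ge> 1" using I(3) by (metis Suc_le_D Suc_1 Suc_le_mono One_nat_def)
  define A where "A = 8 * (q + 1)"
  define k where "k = 8 * (q * v) + e"
  define s where "s = m - ((e + r - 1) choose (r - 1))"
  note S = open_simplex_card[OF I(1), of n r]
  have "(e + r - 1) choose (r - 1) > 0" by simp
  then have "m > 0" using m(1) by linarith
  have Apos: "A > 0" by (simp add: A_def)
  have rv: "r + e \<le> A * v"
    using dividend_less_times_div[OF Apos, of "r + e"] unfolding v(1) A_def[symmetric]
    by simp
  have "fact e * A ^ e \<ge> A"
    using I(3) Apos
      by (metis fact_ge_1 le_trans mult_le_mono nat_mult_1 self_le_power Suc_le_eq One_nat_def zero_less_Suc less_le_trans Suc_1)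
  then have vA: "A \<le> v" using v(2) unfolding A_def[symmetric] by linarith
  have "e \<le> fact e" by (rule fact_ge_self)
  also have "\<dots> \<le> fact e * A ^ e" using Apos by simp
  finally have ve: "e \<le> v" using v(2) unfolding A_def[symmetric] by linarith
  \<comment> \<open>The room \<open>r - k\<close> is 8v up to rounding errors, which
    \<open>A \<le> v\<close> and \<open>e \<le> v\<close> absorb. Of the \<open>2 * v\<close>
    retained, one \<open>v\<close> is the height of the cone and the other the distance from degree
    \<open>r\<close> that every point of \<open>D\<close> keeps.\<close>
  have "A * (v - 1) \<le> r + e" unfolding v(1) A_def[symmetric]
    by (simp add: times_div_less_eq_dividend)
  then have "A * v \<le> r + e + A" by (simp add: v(1) algebra_simps)
  moreover have "A * v = 8 * (q * v) + 8 * v" by (simp add: A_def algebra_simps)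
  ultimately have gap: "k + 2 * v \<le> r" using vA ve by (simp add: k_def)
  obtain p where p: "p \<in> simplex I k" "p \<notin> B"
    using simplex_not_subset[OF I q _ _ \<open>m > 0\<close> m(2) inj, of v] rv v(1)
      unfolding k_def A_def by auto
  define D where "D = (\<lambda>b l. p l + b l) ` simplex I v"
  have shift: "(\<lambda>l. p l + b l) \<in> open_simplex I r - B \<and> sum (\<lambda>l. p l + b l) I + v \<le> r"
    if b: "b \<in> simplex I v" for b
  proof -
    have *: "(\<lambda>l. p l + b l) \<notin> B"
    proof
      assume "(\<lambda>l. p l + b l) \<in> B"
      then have "p \<in> B" by (rule down) (auto simp: le_fun_def)
      then show False using p by simp
    qed
    have "sum (\<lambda>l. p l + b l) I \<le> k + v"
      using p b unfolding sum.distrib by (auto simp: simplex_def)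
    with * show ?thesis
      using gap p b v(1) by (auto simp: open_simplex_def simplex_def vecs_def)
  qed
  have D: "D \<subseteq> open_simplex I r - B" and Dv: "\<And>a. a \<in> D \<Longrightarrow> sum a I + v \<le> r"
    using shift unfolding D_def by blast+
  have cardD: "card D = (v + e) choose e"
  proof -
    have "inj (\<lambda>b l. p l + b l)" by (auto simp: inj_def fun_eq_iff)
    then have "card D = card (simplex I v)" unfolding D_def
      by (intro card_image) (auto intro: inj_on_subset)
    then show ?thesis using simplex_card[OF I(1)] I(2) by simp
  qed
  have symm: "(e + r - 1) choose (r - 1) = (r + n) choose Suc n"
    using binomial_symmetric[of "r - 1" "r + n"] r n(1) by (simp add: add.commute)
  \<comment> \<open>By Pascal's rule the bracket around \<open>m\<close> leaves \<open>s\<close>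
    below the number of vectors of degree \<open>r\<close>, which is of order r^(e-1).\<close>
  have "((e + r) choose r) = ((e + r - 1) choose (r - 1)) + ((e + r - 1) choose r)"
    using r n(1) by (cases r) auto
  then have "s < (e + r - 1) choose r" using m unfolding s_def by linarith
  also have "\<dots> = (n + r) choose n" using binomial_symmetric[of r "n + r"] n(1) by simp
  also have "\<dots> \<le> (n + r) ^ n" by (intro binomial_le_pow) simp
  finally have "s < (n + r) ^ n" .
  then have "s * (r + 1) \<le> (n + r) ^ n * (r + 1)" by (intro mult_le_mono) auto
  also have "\<dots> \<le> (r + e) ^ n * (r + e)" using n by (intro mult_le_mono power_mono) auto
  also have "\<dots> = (r + e) ^ e" by (simp add: n(1))
  also have "\<dots> \<le> (A * v) ^ e" using rv by (intro power_mono) auto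
  finally have "s * (r + 1) \<le> A ^ e * v ^ e" by (simp add: power_mult_distrib)
  then have "fact e * (s * (r + 1)) \<le> (fact e * A ^ e) * v ^ e" by (simp add: mult.assoc)
  also have "\<dots> < v * v ^ e"
    using v(2) v(1) by (intro mult_strict_right_mono) (auto simp: A_def)
  also have "\<dots> \<le> v * (fact e * card D)"
    unfolding cardD by (intro mult_left_mono pow_le_fact_binomial) simp
  also have "\<dots> = fact e * (card D * v)" by (simp only: mult_ac)
  finally have gain: "s * (r + 1) < card D * v" by (simp only: mult_less_cancel1)
  have cardB: "card B \<le> card (open_simplex I r) + s"
    using B(4) m(1) S I n unfolding s_def symm by simp
  have "real (card (corners I B)) \<le> 1 + real n * (\<Sum>b\<in>B. 1 / (real (sum b I) + 1))"
    using card_corners_le[OF I(1) B(1-3)] down I(2) n(1) by (simp add: le_fun_def)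
  also have "\<dots> < 1 + real n * (\<Sum>b\<in>open_simplex I r. 1 / (real (sum b I) + 1))"
    using weight_less_open_simplex[OF I(1) _ B(1,2) cardB D Dv gain, of n] n I(2) by simp
  also have "\<dots> = real ((n + r) choose r)" using I n by (intro open_simplex_weight) auto
  finally show ?thesis by (simp add: n(1))
qed

section \<open>Irredundant generating sets of the kernel congruence\<close>

text \<open>Steinitz exchange. For \<open>x\<close> in \<open>X - Y\<close>, a smallest part
  \<open>Z\<close> of \<open>Y\<close> spanning \<open>x\<close> cannot lie in \<open>X\<close>, by
  independence. So some \<open>y\<close> in \<open>Z - X\<close> can be replaced by
  \<open>x\<close>, which preserves the size and the span condition and shrinks
  \<open>X - Y\<close>.\<close>

lemma card_le_of_exchange:
  fixes cl :: "'a set \<Rightarrow> 'a set"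
  assumes extensive: "\<And>X. X \<subseteq> cl X"
    and least: "\<And>X Y. X \<subseteq> cl Y \<Longrightarrow> cl X \<subseteq> cl Y"
    and exchange: "\<And>x y X. x \<in> cl (insert y X) \<Longrightarrow> x \<notin> cl X \<Longrightarrow> y \<in> cl (insert x X)"
    and "finite X" "finite Y" "X \<subseteq> cl Y"
    and indep: "\<And>x. x \<in> X \<Longrightarrow> x \<notin> cl (X - {x})"
  shows "card X \<le> card Y"
  using \<open>finite Y\<close> \<open>X \<subseteq> cl Y\<close>
proof (induction "card (X - Y)" arbitrary: Y rule: less_induct)
  case less
  have mono: "cl S \<subseteq> cl T" if "S \<subseteq> T" for S T
    using least[of S T] extensive[of T] that by blast
  show ?case
  proof (cases "X \<subseteq> Y")
    case True
    then show ?thesis using less.prems(1) by (rule card_mono[rotated])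
  next
    case False
    then obtain x where x: "x \<in> X" "x \<notin> Y" by blast
    let ?P = "\<lambda>Z. X \<inter> Y \<subseteq> Z \<and> Z \<subseteq> Y \<and> x \<in> cl Z"
    have "?P Y" using x less.prems by blast
    then obtain Z where Z: "?P Z" and minZ: "\<And>Z'. ?P Z' \<Longrightarrow> card Z \<le> card Z'"
      using ex_has_least_nat[of ?P Y card] by blast
    have "\<not> Z \<subseteq> X"
    proof
      assume "Z \<subseteq> X"
      then have "cl Z \<subseteq> cl (X - {x})" using Z x by (intro mono) blast
      then show False using indep[OF x(1)] Z by blast
    qed
    then obtain y where y: "y \<in> Z" "y \<notin> X" by blast
    have finZ: "finite Z" using Z less.prems(1) finite_subset by blast
    have "x \<notin> cl (Z - {y})"
    proof
      assume "x \<in> cl (Z - {y})"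
      then have "?P (Z - {y})" using Z y by blast
      then have "card Z \<le> card (Z - {y})" by (rule minZ)
      then show False using card_Diff1_less[OF finZ y(1)] by simp
    qed
    moreover have "x \<in> cl (insert y (Z - {y}))" using Z y by (simp add: insert_absorb)
    ultimately have yx: "y \<in> cl (insert x (Z - {y}))" using exchange by blast
    let ?Y = "insert x (Y - {y})"
    have "y \<in> cl ?Y" using yx mono[of "insert x (Z - {y})" ?Y] Z by blast
    then have "Y \<subseteq> cl ?Y" using extensive[of ?Y] by blast
    then have "X \<subseteq> cl ?Y" using less.prems(2) least by blast
    moreover have "card (X - ?Y) < card (X - Y)"
      using x y \<open>finite X\<close> by (intro psubset_card_mono) auto
    ultimately have "card X \<le> card ?Y" using less.prems(1) less.hyps[of ?Y] by simp
    also have "\<dots> = card Y"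
      using x y Z less.prems(1)
        by (simp add: card_Diff_singleton_if) (metis card_Suc_Diff1 card_gt_0_iff Suc_pred empty_iff subsetD)
    finally show ?thesis .
  qed
qed

section \<open>Generation of the kernel as connectivity of fibres\<close>

locale positive_weights =
  fixes n :: nat and g :: "nat \<Rightarrow> nat"
  assumes weight_pos: "i < n \<Longrightarrow> 0 < g i"
begin

definition val :: "(nat \<Rightarrow> nat) \<Rightarrow> nat" where
  "val a = (\<Sum>i<n. a i * g i)"

definition ker :: "((nat \<Rightarrow> nat) \<times> (nat \<Rightarrow> nat)) set" where
  "ker = {(a, b). a \<in> nat_vecs n \<and> b \<in> nat_vecs n \<and> val a = val b}"

text \<open>The analogue of the maximal ideal times the toric ideal: as in the graded Nakayama
  lemma, generation is tested modulo these relations.\<close>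

definition proper_translates :: "((nat \<Rightarrow> nat) \<times> (nat \<Rightarrow> nat)) set" where
  "proper_translates = {(\<lambda>i. a i + d i, \<lambda>i. b i + d i) | a b d.
     (a, b) \<in> ker \<and> d \<in> nat_vecs n \<and> d \<noteq> (\<lambda>_. 0)}"

text \<open>Up to relations that are translates of relations of smaller degree, a set generates the
  kernel iff it connects every fibre of \<open>val\<close>. This turns the graded notion of generation into the
  closure operator of a graphic matroid, in which irredundant sets are independent.\<close>

definition ker_span :: "((nat \<Rightarrow> nat) \<times> (nat \<Rightarrow> nat)) set \<Rightarrow> ((nat \<Rightarrow> nat) \<times> (nat \<Rightarrow> nat)) set" where
  "ker_span X = (proper_translates \<union> X \<union> X\<inverse>)\<^sup>*"

lemma val_add: "val (\<lambda>i. a i + b i) = val a + val b"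
  by (simp add: val_def sum.distrib distrib_right)

lemma nat_vecs_add: "a \<in> nat_vecs n \<Longrightarrow> b \<in> nat_vecs n \<Longrightarrow> (\<lambda>i. a i + b i) \<in> nat_vecs n"
  by (simp add: nat_vecs_def)

lemma val_pos:
  assumes "d \<in> nat_vecs n" "d \<noteq> (\<lambda>_. 0)"
  shows "0 < val d"
proof -
  obtain i where i: "d i \<noteq> 0" using assms(2) by auto
  then have "i < n" using assms(1) by (cases "i < n") (auto simp: nat_vecs_def)
  then show ?thesis using i weight_pos[of i] unfolding val_def by (intro sum_pos2[of _ i]) auto
qed

lemma proper_translates_sub_ker: "proper_translates \<subseteq> ker"
  by (auto simp: proper_translates_def ker_def val_add nat_vecs_add)

lemma vec_congruence_ker: "vec_congruence n ker"
  unfolding vec_congruence_def equiv_def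
  by (auto simp: ker_def refl_on_def sym_def trans_def val_add nat_vecs_add)

lemma sym_ker_span: "sym (ker_span X)"
proof -
  have "sym proper_translates"
    by (auto simp: proper_translates_def ker_def sym_def) metis
  then show ?thesis unfolding ker_span_def
    by (intro sym_rtrancl) (auto simp: sym_def)
qed

lemma trans_ker_span: "trans (ker_span X)"
  unfolding ker_span_def by (rule trans_rtrancl)

lemma ker_span_extensive: "X \<subseteq> ker_span X"
  by (auto simp: ker_span_def)

lemma ker_span_least: "X \<subseteq> ker_span Y \<Longrightarrow> ker_span X \<subseteq> ker_span Y"
proof -
  assume X: "X \<subseteq> ker_span Y"
  then have "X\<inverse> \<subseteq> ker_span Y" using sym_ker_span[of Y] by (auto simp: sym_def)
  moreover have "proper_translates \<subseteq> ker_span Y" by (auto simp: ker_span_def)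
  ultimately have "proper_translates \<union> X \<union> X\<inverse> \<subseteq> (proper_translates \<union> Y \<union> Y\<inverse>)\<^sup>*"
    using X by (simp add: ker_span_def)
  then show ?thesis unfolding ker_span_def by (rule rtrancl_subset_rtrancl)
qed

text \<open>A path needs the new edge between \<open>a\<close> and \<open>b\<close> at most once, in
  one of its two directions.\<close>

lemma ker_span_insert:
  assumes "(c, d) \<in> ker_span (insert (a, b) X)"
  shows "(c, d) \<in> ker_span X \<or> (c, a) \<in> ker_span X \<and> (b, d) \<in> ker_span X
    \<or> (c, b) \<in> ker_span X \<and> (a, d) \<in> ker_span X"
  using assms unfolding ker_span_def[of "insert (a, b) X"]
proof (induction rule: rtrancl_induct)
  case base
  then show ?case by (simp add: ker_span_def)
next
  case (step y z)
  have "(y, z) \<in> ker_span X \<or> (y, z) = (a, b) \<or> (y, z) = (b, a)"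
    using step.hyps(2) by (auto simp: ker_span_def)
  moreover have "(x, x) \<in> ker_span X" for x by (simp add: ker_span_def)
  ultimately show ?case using step.IH trans_ker_span[of X] sym_ker_span[of X]
    unfolding trans_def sym_def by blast
qed

text \<open>A path joining the ends of \<open>x\<close> must cross the edge \<open>y\<close>; its
  two remaining pieces, together with the edge \<open>x\<close>, join the ends of
  \<open>y\<close>.\<close>

lemma ker_span_exchange:
  assumes "x \<in> ker_span (insert y X)" "x \<notin> ker_span X"
  shows "y \<in> ker_span (insert x X)"
proof -
  obtain a b c d where eq: "x = (c, d)" "y = (a, b)" by fastforce
  have mono: "ker_span X \<subseteq> ker_span (insert x X)"
    using ker_span_extensive[of "insert x X"] by (intro ker_span_least) blast
  have x: "(c, d) \<in> ker_span (insert x X)" using ker_span_extensive[of "insert x X"] eq by blast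
  have "(c, a) \<in> ker_span X \<and> (b, d) \<in> ker_span X \<or> (c, b) \<in> ker_span X \<and> (a, d) \<in> ker_span X"
    using ker_span_insert assms eq by blast
  then show ?thesis using mono x trans_ker_span[of "insert x X"] sym_ker_span[of "insert x X"]
    unfolding trans_def sym_def eq by blast
qed

text \<open>In one direction, \<open>ker \<inter> ker_span X\<close> is itself a congruence, because
  adding a nonzero vector to a relation lands in \<open>proper_translates\<close>. In the other,
  induction on \<open>val\<close> applies: a proper translate comes from a relation of strictly
  smaller value, which is already generated.\<close>

lemma generates_ker_iff:
  assumes X: "X \<subseteq> ker"
  shows "vec_congruence n hull X = ker \<longleftrightarrow> ker \<subseteq> ker_span X"
proof
  assume hull: "vec_congruence n hull X = ker"
  have "vec_congruence n (ker \<inter> ker_span X)"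
    unfolding vec_congruence_def
  proof (intro conjI)
    show "equiv (nat_vecs n) (ker \<inter> ker_span X)"
    proof (rule equivI)
      show "ker \<inter> ker_span X \<subseteq> nat_vecs n \<times> nat_vecs n" by (auto simp: ker_def)
      show "refl_on (nat_vecs n) (ker \<inter> ker_span X)"
        by (auto simp: refl_on_def ker_def ker_span_def)
      have "equiv (nat_vecs n) ker" using vec_congruence_ker by (simp add: vec_congruence_def)
      then show "sym (ker \<inter> ker_span X)" "trans (ker \<inter> ker_span X)"
        using sym_ker_span trans_ker_span by (auto simp: equiv_def intro: sym_Int trans_Int)
    qed
    show "\<forall>(a, b)\<in>ker \<inter> ker_span X. \<forall>c\<in>nat_vecs n.
        (\<lambda>i. a i + c i, \<lambda>i. b i + c i) \<in> ker \<inter> ker_span X"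
    proof clarify
      fix a b c assume ab: "(a, b) \<in> ker" "(a, b) \<in> ker_span X" and c: "c \<in> nat_vecs n"
      show "(\<lambda>i. a i + c i, \<lambda>i. b i + c i) \<in> ker \<inter> ker_span X"
      proof (cases "c = (\<lambda>_. 0)")
        case True
        then show ?thesis using ab by simp
      next
        case False
        then have "(\<lambda>i. a i + c i, \<lambda>i. b i + c i) \<in> proper_translates"
          using ab c by (auto simp: proper_translates_def)
        then show ?thesis using proper_translates_sub_ker by (auto simp: ker_span_def)
      qed
    qed
  qed
  moreover have "X \<subseteq> ker \<inter> ker_span X" using X ker_span_extensive by blast
  ultimately have "vec_congruence n hull X \<subseteq> ker \<inter> ker_span X" by (rule hull_minimal[rotated])
  then show "ker \<subseteq> ker_span X" using hull by blast
next
  assume span: "ker \<subseteq> ker_span X"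
  have "ker \<subseteq> R" if R: "vec_congruence n R" "X \<subseteq> R" for R
  proof -
    have equiv: "refl_on (nat_vecs n) R" "sym R" "trans R"
      and transl: "\<And>a b c. (a, b) \<in> R \<Longrightarrow> c \<in> nat_vecs n \<Longrightarrow> (\<lambda>i. a i + c i, \<lambda>i. b i + c i) \<in> R"
      using R(1) unfolding vec_congruence_def equiv_def by auto
    have "(a, b) \<in> R" if "(a, b) \<in> ker" for a b
      using that
    proof (induction "val a" arbitrary: a b rule: less_induct)
      case less
      have a: "a \<in> nat_vecs n" using less.prems by (simp add: ker_def)
      have "(a, b) \<in> (proper_translates \<union> X \<union> X\<inverse>)\<^sup>*"
        using span less.prems by (auto simp: ker_span_def)
      then have "(a, b) \<in> R \<and> val b = val a"
      proof (induction rule: rtrancl_induct)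
        case base
        then show ?case using equiv(1) a by (auto simp: refl_on_def)
      next
        case (step y z)
        have "(y, z) \<in> ker"
          using step.hyps(2) proper_translates_sub_ker X by (auto simp: ker_def)
        moreover have "(y, z) \<in> R"
        proof (cases "(y, z) \<in> proper_translates")
          case True
          then obtain p q d where pq: "(p, q) \<in> ker" and d: "d \<in> nat_vecs n" "d \<noteq> (\<lambda>_. 0)"
            and yz: "y = (\<lambda>i. p i + d i)" "z = (\<lambda>i. q i + d i)"
            by (auto simp: proper_translates_def)
          have "val p < val a" using step.IH val_pos[OF d] yz by (simp add: val_add)
          then have "(p, q) \<in> R" using less.hyps pq by blast
          then show ?thesis using transl d yz by blast
        next
          case False
          then show ?thesis using step.hyps(2) R(2) equiv(2) by (auto simp: sym_def)
        qed
        ultimately show ?case using step.IH equiv(3) by (auto simp: trans_def ker_def)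
      qed
      then show ?case by blast
    qed
    then show ?thesis by auto
  qed
  then have "ker \<subseteq> vec_congruence n hull X" unfolding hull_def by blast
  moreover have "vec_congruence n hull X \<subseteq> ker" using X vec_congruence_ker by (rule hull_minimal)
  ultimately show "vec_congruence n hull X = ker" by blast
qed

lemma card_irredundant_generators_le:
  assumes "vec_congruence n hull S = ker" "\<And>S'. S' \<subset> S \<Longrightarrow> vec_congruence n hull S' \<noteq> ker"
    and "vec_congruence n hull T = ker" "finite T"
  shows "card S \<le> card T"
\<comment> \<open>An infinite \<open>S\<close> has \<open>card S = 0\<close>, so only the finite
  case has content.\<close>
proof (cases "finite S")
  case True
  have S: "S \<subseteq> ker" and T: "T \<subseteq> ker"
    using hull_subset[of S "vec_congruence n"] hull_subset[of T "vec_congruence n"] assms(1,3) by auto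
  have gen: "ker \<subseteq> ker_span S" "ker \<subseteq> ker_span T"
    using assms(1,3) generates_ker_iff[OF S] generates_ker_iff[OF T] by auto
  show ?thesis
  proof (rule card_le_of_exchange[of ker_span, OF ker_span_extensive ker_span_least ker_span_exchange True assms(4)])
    show "S \<subseteq> ker_span T" using S gen(2) by blast
    show "x \<notin> ker_span (S - {x})" if "x \<in> S" for x
    proof
      assume "x \<in> ker_span (S - {x})"
      then have "S \<subseteq> ker_span (S - {x})" using ker_span_extensive[of "S - {x}"] by blast
      then have "ker \<subseteq> ker_span (S - {x})" using gen(1) ker_span_least by blast
      then have "vec_congruence n hull (S - {x}) = ker"
        using generates_ker_iff[of "S - {x}"] S by blast
      then show False using assms(2)[of "S - {x}"] that by blast
    qed
  qed
qed simp

lemma ex_irredundant_generators: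
  assumes "vec_congruence n hull T = ker" "finite T"
  shows "\<exists>S. vec_congruence n hull S = ker \<and> (\<forall>S'. S' \<subset> S \<longrightarrow> vec_congruence n hull S' \<noteq> ker)"
proof -
  define P where "P S \<longleftrightarrow> finite S \<and> vec_congruence n hull S = ker" for S
  have "P T" using assms by (simp add: P_def)
  then obtain S where S: "P S" "\<And>S'. P S' \<Longrightarrow> card S \<le> card S'"
    using ex_has_least_nat[of P T card] by blast
  have "\<not> P S'" if "S' \<subset> S" for S'
    using S that psubset_card_mono[of S S'] unfolding P_def by (meson not_le)
  moreover have "finite S'" if "S' \<subset> S" for S'
    using S(1) that finite_subset[of S' S] unfolding P_def by blast
  ultimately show ?thesis using S(1) unfolding P_def by metis
qed

end

section \<open>The staircase of minimal factorizations\<close>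

context positive_weights
begin

definition prec :: "(nat \<Rightarrow> nat) \<Rightarrow> (nat \<Rightarrow> nat) \<Rightarrow> bool" where
  "prec a b \<longleftrightarrow> val a < val b \<or> val a = val b \<and> less_fun a b"

lemma prec_trans: "prec a b \<Longrightarrow> prec b c \<Longrightarrow> prec a c"
  by (auto simp: prec_def intro: less_fun_trans)

lemma prec_irrefl: "\<not> prec a a"
  by (auto simp: prec_def less_fun_irrefl)

lemma prec_total:
  assumes "a \<in> nat_vecs n" "b \<in> nat_vecs n" "a \<noteq> b"
  shows "prec a b \<or> prec b a"
proof -
  have "{k. a k \<noteq> b k} \<subseteq> {..<n}"
    using assms(1,2) by (auto simp: nat_vecs_def) (metis not_le)
  then have "finite {k. a k \<noteq> b k}" using finite_subset by blast
  then show ?thesis using less_fun_trichotomy assms(3) unfolding prec_def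
    by (metis linorder_neqE_nat)
qed

lemma prec_add: "prec a b \<Longrightarrow> prec (\<lambda>i. a i + c i) (\<lambda>i. b i + c i)"
  by (auto simp: prec_def val_add less_fun_def)

lemma nat_vecs_eq_vecs: "nat_vecs n = vecs {..<n}"
  by (auto simp: nat_vecs_def vecs_def)

lemma finite_val_le: "finite {a \<in> nat_vecs n. val a \<le> N}"
proof -
  have "sum a {..<n} \<le> val a" for a
    unfolding val_def by (intro sum_mono) (simp add: weight_pos Suc_leI)
  then have "{a \<in> nat_vecs n. val a \<le> N} \<subseteq> simplex {..<n} N"
    by (auto simp: nat_vecs_eq_vecs simplex_def intro: order_trans)
  then show ?thesis using simplex_card[of "{..<n}" N] finite_subset by blast
qed

text \<open>Turns \<open>prec\<close> into a measure in the natural numbers, for least elements and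
  for induction. Positive weights make the set counted here finite.\<close>

definition rank :: "(nat \<Rightarrow> nat) \<Rightarrow> nat" where
  "rank a = card {b \<in> nat_vecs n. prec b a}"

lemma rank_less:
  assumes "a \<in> nat_vecs n" "prec a b"
  shows "rank a < rank b"
  unfolding rank_def
proof (rule psubset_card_mono)
  have "{c \<in> nat_vecs n. prec c b} \<subseteq> {c \<in> nat_vecs n. val c \<le> val b}" by (auto simp: prec_def)
  then show "finite {c \<in> nat_vecs n. prec c b}" using finite_val_le finite_subset by blast
  show "{c \<in> nat_vecs n. prec c a} \<subset> {c \<in> nat_vecs n. prec c b}"
    using assms prec_trans prec_irrefl by blast
qed

abbreviation base :: "(nat \<Rightarrow> nat) set" where
  "base \<equiv> vecs {0<..<n}"

lemma vecs_down:
  assumes "a \<in> vecs I" "b \<le> a"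
  shows "b \<in> vecs I"
  unfolding vecs_def
proof clarify
  fix i assume "i \<notin> I"
  then show "b i = 0" using assms le_funD[OF assms(2), of i] by (simp add: vecs_def)
qed

lemma base_sub: "base \<subseteq> nat_vecs n"
  by (auto simp: nat_vecs_eq_vecs vecs_def)

lemma base_iff: "a \<in> base \<longleftrightarrow> a \<in> nat_vecs n \<and> a 0 = 0"
  by (auto simp: nat_vecs_eq_vecs vecs_def)

text \<open>Representatives of the residues modulo \<open>g 0\<close>: a \<open>val\<close>-minimal vector of its class is a
  factorization of an Apery element, and the lexicographic tie-break selects one of them.
  This is the staircase of an initial ideal.\<close>

definition staircase :: "(nat \<Rightarrow> nat) set" where
  "staircase = {a \<in> base. \<forall>b\<in>base. val b mod g 0 = val a mod g 0 \<longrightarrow> \<not> prec b a}"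

lemma staircase_unique:
  assumes "a \<in> staircase" "b \<in> staircase" "val a mod g 0 = val b mod g 0"
  shows "a = b"
  using assms prec_total[of a b] base_sub unfolding staircase_def by force

lemma inj_on_staircase: "inj_on (\<lambda>a. val a mod g 0) staircase"
  by (auto intro: inj_onI staircase_unique)

text \<open>A smaller vector in the residue class of \<open>b\<close>, translated by
  \<open>a - b\<close>, would be a smaller vector in the class of \<open>a\<close>.\<close>

lemma staircase_down:
  assumes "a \<in> staircase" "b \<le> a"
  shows "b \<in> staircase"
proof -
  have a: "a \<in> base" "\<And>c. c \<in> base \<Longrightarrow> val c mod g 0 = val a mod g 0 \<Longrightarrow> \<not> prec c a"
    using assms(1) by (auto simp: staircase_def)
  define d where "d = (\<lambda>i. a i - b i)"
  have eq: "a = (\<lambda>i. b i + d i)" using assms(2) by (auto simp: d_def le_fun_def)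
  have b: "b \<in> base" "d \<in> base" using vecs_down[OF a(1)] assms(2) by (auto simp: d_def le_fun_def)
  have "\<not> prec c b" if c: "c \<in> base" "val c mod g 0 = val b mod g 0" for c
  proof
    assume "prec c b"
    then have "prec (\<lambda>i. c i + d i) a" unfolding eq by (rule prec_add)
    moreover have "(\<lambda>i. c i + d i) \<in> base" using c(1) b(2) by (auto simp: vecs_def)
    moreover have "val (\<lambda>i. c i + d i) mod g 0 = val a mod g 0"
      using c(2) unfolding eq val_add by (metis mod_add_left_eq)
    ultimately show False using a(2) by blast
  qed
  then show ?thesis using b by (auto simp: staircase_def)
qed

lemma zero_in_staircase: "(\<lambda>_. 0) \<in> staircase"
  by (auto simp: staircase_def prec_def val_def less_fun_def vecs_def)

lemma finite_staircase:
  assumes "0 < n"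
  shows "finite staircase \<and> card staircase \<le> g 0"
proof -
  have sub: "(\<lambda>a. val a mod g 0) ` staircase \<subseteq> {..<g 0}" using weight_pos[OF assms] by auto
  then have "finite staircase" using inj_on_staircase inj_on_finite by blast
  then show ?thesis using card_inj_on_le[OF inj_on_staircase sub] by simp
qed

lemma ex_staircase_rep:
  assumes "a \<in> base"
  obtains b where "b \<in> staircase" "val b mod g 0 = val a mod g 0" "b = a \<or> prec b a"
proof -
  let ?P = "\<lambda>b. b \<in> base \<and> val b mod g 0 = val a mod g 0"
  have "?P a" using assms by simp
  then obtain b where b: "?P b" "\<And>c. ?P c \<Longrightarrow> rank b \<le> rank c"
    using ex_has_least_nat[of ?P a rank] by blast
  then have min: "\<not> prec c b" if "?P c" for c
    using that rank_less[of c b] base_sub by (meson not_le subsetD)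
  then have "b \<in> staircase" using b(1) by (auto simp: staircase_def)
  moreover have "b = a \<or> prec b a"
    using prec_total[of a b] min[of a] assms b(1) base_sub by blast
  ultimately show thesis using that b(1) by blast
qed

section \<open>Normal forms and the presentation by corners\<close>

lemma val_split:
  assumes "0 < n"
  shows "val a = a 0 * g 0 + val (a(0 := 0))"
proof -
  have "val a = a 0 * g 0 + (\<Sum>i\<in>{..<n} - {0}. a i * g i)"
    unfolding val_def using assms by (simp add: sum.remove)
  also have "(\<Sum>i\<in>{..<n} - {0}. a i * g i) = (\<Sum>i<n. (a(0 := 0)) i * g i)"
    by (rule sum.mono_neutral_cong_left) auto
  finally show ?thesis by (simp add: val_def)
qed

text \<open>The standard monomials: coordinate 0 is unrestricted, since copies of \<open>g 0\<close>
  do not change the residue.\<close>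

definition normal :: "(nat \<Rightarrow> nat) set" where
  "normal = {a \<in> nat_vecs n. a(0 := 0) \<in> staircase}"

lemma normal_unique:
  assumes "0 < n" "a \<in> normal" "b \<in> normal" "val a = val b"
  shows "a = b"
proof -
  note s = val_split[OF assms(1), of a] val_split[OF assms(1), of b]
  have "val (a(0 := 0)) mod g 0 = val (b(0 := 0)) mod g 0"
    using s assms(4) by (metis mod_mult_self3)
  then have eq: "a(0 := 0) = b(0 := 0)" using assms staircase_unique by (auto simp: normal_def)
  then have "a 0 = b 0" using s assms(4) weight_pos[OF assms(1)] by simp
  then show ?thesis using eq by (metis fun_upd_triv fun_upd_upd)
qed

lemma ex_normal:
  assumes "0 < n" "a \<in> nat_vecs n"
  obtains b where "b \<in> normal"
    "val b = val a" "b(0 := 0) = a(0 := 0) \<or> prec (b(0 := 0)) (a(0 := 0))"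
proof -
  have "a(0 := 0) \<in> base" using assms(2) by (auto simp: base_iff nat_vecs_def)
  then obtain b where b: "b \<in> staircase" "val b mod g 0 = val (a(0 := 0)) mod g 0"
    "b = a(0 := 0) \<or> prec b (a(0 := 0))"
    by (rule ex_staircase_rep)
  have b0: "b \<in> nat_vecs n" "b 0 = 0" using b(1) by (auto simp: staircase_def base_iff)
  have "val b \<le> val (a(0 := 0))" using b(3) by (auto simp: prec_def)
  \<comment> \<open>The value lost in passing to the representative is a multiple of
    \<open>g 0\<close>; it is returned as \<open>k\<close> further copies in coordinate 0.\<close>
  then obtain k where k: "val (a(0 := 0)) = val b + g 0 * k"
    using b(2) mod_eq_dvd_iff_nat[of "val b" "val (a(0 := 0))" "g 0"]
    by (metis dvdE le_add_diff_inverse)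
  define c where "c = b(0 := a 0 + k)"
  have c0: "c(0 := 0) = b" using b0(2) by (auto simp: c_def fun_eq_iff)
  have "c \<in> nat_vecs n" using b0(1) assms(1) by (auto simp: c_def nat_vecs_def)
  then have "c \<in> normal" using c0 b(1) by (simp add: normal_def)
  moreover have "val c = val a"
    using val_split[OF assms(1), of c] val_split[OF assms(1), of a] k c0
    by (simp add: c_def algebra_simps)
  ultimately show thesis using that b(3) c0 by blast
qed

lemma ex_corner_le:
  assumes "a \<in> base" "a \<notin> staircase"
  obtains c where "c \<in> corners {0<..<n} staircase" "c \<le> a"
proof -
  let ?P = "\<lambda>c. c \<notin> staircase \<and> c \<le> a"
  have "?P a" using assms by simp
  then obtain c where c: "?P c" "\<And>d. ?P d \<Longrightarrow> sum c {0<..<n} \<le> sum d {0<..<n}"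
    using ex_has_least_nat[of ?P a "\<lambda>c. sum c {0<..<n}"] by blast
  have "c \<in> base" using c(1) vecs_down[OF assms(1)] by blast
  moreover have "c(i := c i - 1) \<in> staircase" if i: "i \<in> {0<..<n}" "c i > 0" for i
  proof (rule ccontr)
    assume "c(i := c i - 1) \<notin> staircase"
    moreover have "c(i := c i - 1) \<le> a" using c(1)
      by (auto simp: le_fun_def intro: le_trans diff_le_self)
    ultimately have "sum c {0<..<n} \<le> sum (c(i := c i - 1)) {0<..<n}" using c(2) by blast
    moreover have "sum (c(i := c i - 1)) {0<..<n} < sum c {0<..<n}"
      using i by (intro sum_strict_mono_ex1) auto
    ultimately show False by simp
  qed
  ultimately have "c \<in> corners {0<..<n} staircase" using c(1) unfolding corners_def by blast
  then show thesis using that c(1) by blast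
qed

text \<open>Division with remainder: a vector that is not normal lies above a corner
  \<open>c\<close>, and replacing \<open>c\<close> by \<open>nf c\<close> is a translate of a
  relation in \<open>T\<close>. Repetition ends at the normal form, which depends only on the
  value.\<close>

lemma corners_generate_ker:
  assumes "0 < n"
  obtains T where "vec_congruence n hull T = ker" "finite T"
    "card T \<le> card (corners {0<..<n} staircase)"
proof -
  let ?M = "corners {0<..<n} staircase"
  have "\<exists>b. b \<in> normal \<and> val b = val a \<and> (b(0 := 0) = a(0 := 0) \<or> prec (b(0 := 0)) (a(0 := 0)))"
    if "a \<in> nat_vecs n" for a
    using ex_normal[OF assms that] by metis
  then obtain nf where nf: "\<And>a. a \<in> nat_vecs n \<Longrightarrow> nf a \<in> normal"
    "\<And>a. a \<in> nat_vecs n \<Longrightarrow> val (nf a) = val a"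
      "\<And>a. a \<in> nat_vecs n \<Longrightarrow> (nf a)(0 := 0) = a(0 := 0) \<or> prec ((nf a)(0 := 0)) (a(0 := 0))"
    by metis
  have nf_vecs: "nf a \<in> nat_vecs n" if "a \<in> nat_vecs n" for a
    using nf(1)[OF that] by (simp add: normal_def)
  have nf_eqI: "nf a = nf b" if "a \<in> nat_vecs n" "b \<in> nat_vecs n" "val a = val b" for a b
    using normal_unique[OF assms] nf(1,2) that by simp
  have M: "c \<in> nat_vecs n" "c 0 = 0" "c \<notin> staircase" if "c \<in> ?M" for c
    using that by (auto simp: corners_def base_iff)
  define T where "T = (\<lambda>c. (c, nf c)) ` ?M"
  have "T \<subseteq> ker" using M(1) nf_vecs nf(2) by (auto simp: T_def ker_def)
  then have "vec_congruence n hull T \<subseteq> ker" using vec_congruence_ker by (rule hull_minimal)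
  moreover have "ker \<subseteq> R" if R: "vec_congruence n R" "T \<subseteq> R" for R
  proof -
    have equiv: "refl_on (nat_vecs n) R" "sym R" "trans R"
      and transl: "\<And>a b c. (a, b) \<in> R \<Longrightarrow> c \<in> nat_vecs n \<Longrightarrow> (\<lambda>i. a i + c i, \<lambda>i. b i + c i) \<in> R"
      using R(1) unfolding vec_congruence_def equiv_def by auto
    have to_nf: "(a, nf a) \<in> R" if "a \<in> nat_vecs n" for a
      using that
    \<comment> \<open>Rewriting preserves \<open>val\<close>, so the measure omits coordinate 0: the
      part without copies of \<open>g 0\<close> is what decreases for \<open>prec\<close>.\<close>
    proof (induction "rank (a(0 := 0))" arbitrary: a rule: less_induct)
      case less
      have a0: "a(0 := 0) \<in> base" using less.prems by (auto simp: base_iff nat_vecs_def)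
      show ?case
      proof (cases "a(0 := 0) \<in> staircase")
        case True
        then have "a \<in> normal" using less.prems by (simp add: normal_def)
        then have "nf a = a" using normal_unique[OF assms] nf(1,2) less.prems by blast
        then show ?thesis using equiv(1) less.prems by (simp add: refl_on_def)
      next
        case False
        then obtain c where c: "c \<in> ?M" "c \<le> a(0 := 0)" using ex_corner_le a0 by blast
        define d where "d = (\<lambda>i. a i - c i)"
        have ca: "c i \<le> a i" for i using c(2)
          by (auto simp: le_fun_def split: if_splits dest: spec[of _ i])
        have eq: "a = (\<lambda>i. c i + d i)" using ca by (auto simp: d_def)
        have d: "d \<in> nat_vecs n" using less.prems by (auto simp: d_def nat_vecs_def)
        define b where "b = (\<lambda>i. nf c i + d i)"
        have b: "b \<in> nat_vecs n" unfolding b_def using nf_vecs M(1) c(1) d nat_vecs_add by blast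
        have "(a, b) \<in> R" unfolding eq b_def using R(2) c(1) d transl by (auto simp: T_def)
        have c0: "c(0 := 0) = c" using M(2)[OF c(1)] by (auto simp: fun_eq_iff)
        have "(nf c)(0 := 0) \<noteq> c"
          using nf(1)[OF M(1)[OF c(1)]] M(3)[OF c(1)] by (auto simp: normal_def)
        then have "prec ((nf c)(0 := 0)) c" using nf(3)[OF M(1)[OF c(1)]] c0 by simp
        then have "prec (\<lambda>i. ((nf c)(0 := 0)) i + (d(0 := 0)) i) (\<lambda>i. c i + (d(0 := 0)) i)"
          by (rule prec_add)
        moreover have "(\<lambda>i. ((nf c)(0 := 0)) i + (d(0 := 0)) i) = b(0 := 0)"
          by (auto simp: b_def fun_eq_iff)
        moreover have "(\<lambda>i. c i + (d(0 := 0)) i) = a(0 := 0)"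
          using M(2)[OF c(1)] by (auto simp: eq fun_eq_iff)
        ultimately have "prec (b(0 := 0)) (a(0 := 0))" by simp
        moreover have "b(0 := 0) \<in> nat_vecs n" using b by (auto simp: nat_vecs_def)
        ultimately have "(b, nf b) \<in> R" using less.hyps rank_less b by blast
        moreover have "nf b = nf a"
          using b less.prems nf(2)[OF M(1)[OF c(1)]] unfolding eq b_def
          by (intro nf_eqI) (auto simp: val_add)
        ultimately show ?thesis using \<open>(a, b) \<in> R\<close> equiv(3) by (auto simp: trans_def)
      qed
    qed
    show "ker \<subseteq> R"
    proof clarify
      fix a b assume "(a, b) \<in> ker"
      then have "a \<in> nat_vecs n" "b \<in> nat_vecs n" "nf a = nf b"
        using nf_eqI[of a b] by (auto simp: ker_def)
      then have "(a, nf a) \<in> R" "(b, nf a) \<in> R" using to_nf[of a] to_nf[of b] by simp_all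
      then show "(a, b) \<in> R" using equiv by (meson symD transD)
    qed
  qed
  then have "ker \<subseteq> vec_congruence n hull T" unfolding hull_def by blast
  moreover have "finite ?M"
    using finite_staircase[OF assms] zero_in_staircase by (intro finite_corners) auto
  ultimately show thesis using that[of T] card_image_le[of ?M "\<lambda>c. (c, nf c)"] by (auto simp: T_def)
qed

end

section \<open>Generators of numerical monoids\<close>

definition atoms :: "nat set \<Rightarrow> nat set" where
  "atoms H = {x \<in> H. x \<noteq> 0 \<and> (\<forall>y\<in>H. \<forall>z\<in>H. x = y + z \<longrightarrow> y = 0 \<or> z = 0)}"

text \<open>Removing an atom from \<open>H\<close> leaves a submonoid, so no generating set can miss
  it.\<close>

lemma atoms_subset_generators:
  assumes H: "add_submonoid H" and G: "add_submonoid hull G = H"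
  shows "atoms H \<subseteq> G"
proof (rule ccontr)
  assume "\<not> atoms H \<subseteq> G"
  then obtain x where x: "x \<in> atoms H" "x \<notin> G" by blast
  have "y + z \<noteq> x" if "y \<in> H - {x}" "z \<in> H - {x}" for y z
    using x(1) that by (cases "y = 0"; cases "z = 0") (auto simp: atoms_def)
  then have "add_submonoid (H - {x})"
    using H x(1) unfolding add_submonoid_def atoms_def by blast
  moreover have "G \<subseteq> H - {x}" using hull_subset[of G add_submonoid] G x(2) by auto
  ultimately have "add_submonoid hull G \<subseteq> H - {x}" by (rule hull_minimal[rotated])
  then show False using G x(1) by (auto simp: atoms_def)
qed

lemma atoms_generate:
  assumes H: "add_submonoid H"
  shows "add_submonoid hull (atoms H) = H"
proof
  show "add_submonoid hull (atoms H) \<subseteq> H" using H by (intro hull_minimal) (auto simp: atoms_def)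
  have "x \<in> K" if "x \<in> H" and K: "add_submonoid K" "atoms H \<subseteq> K" for x K
    using that(1)
  proof (induction x rule: less_induct)
    case (less x)
    consider "x = 0" | "x \<in> atoms H" | y z where "y \<in> H" "z \<in> H" "x = y + z" "y \<noteq> 0" "z \<noteq> 0"
      using less.prems unfolding atoms_def by blast
    then show ?case
    proof cases
      case 3
      then show ?thesis using less.IH[of y] less.IH[of z] K(1) by (auto simp: add_submonoid_def)
    qed (use K in \<open>auto simp: add_submonoid_def\<close>)
  qed
  then show "H \<subseteq> add_submonoid hull (atoms H)" unfolding hull_def by blast
qed

lemma min_gens_eq_atoms:
  assumes "add_submonoid H"
  shows "min_gens H = atoms H"
  unfolding min_gens_def
proof (rule the_equality)
  show "minimal_generating_set H (atoms H)"
    using atoms_generate[OF assms] atoms_subset_generators[OF assms]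
    unfolding minimal_generating_set_def by blast
  show "G = atoms H" if "minimal_generating_set H G" for G
    using that atoms_generate[OF assms] atoms_subset_generators[OF assms, of G]
    unfolding minimal_generating_set_def by blast
qed

lemma gen_properties:
  assumes "add_submonoid H" "nm_edim H = Suc k"
  shows "gen H 0 = nm_mult H" and "\<And>i. i < nm_edim H \<Longrightarrow> 0 < gen H i"
proof -
  have fin: "finite (min_gens H)" using assms(2) by (intro card_ge_0_finite) (simp add: nm_edim_def)
  have ne: "min_gens H \<noteq> {}" using assms(2) by (auto simp: nm_edim_def)
  show "gen H 0 = nm_mult H"
    by (simp add: gen_def nm_mult_def sorted_list_of_set_nonempty[OF fin ne])
  fix i assume "i < nm_edim H"
  then have "gen H i \<in> min_gens H"
    using fin unfolding gen_def nm_edim_def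
    by (metis nth_mem set_sorted_list_of_set length_sorted_list_of_set)
  then show "0 < gen H i" using min_gens_eq_atoms[OF assms(1)] by (auto simp: atoms_def)
qed

text \<open>The monoid generated by the interval from \<open>m\<close> to \<open>m + e\<close>: sums
  of \<open>k\<close> generators fill the interval from \<open>k * m\<close> to
  \<open>k * (m + e)\<close>. It ensures that the \<open>Max\<close> in \<open>max_relations\<close>
  ranges over a nonempty set.\<close>

lemma ex_numerical_monoid:
  assumes "0 < e" "e < m"
  shows "\<exists>\<Gamma>. numerical_monoid \<Gamma> \<and> nm_edim \<Gamma> = e + 1 \<and> nm_mult \<Gamma> = m"
proof -
  define H where "H = {x. \<exists>k. k * m \<le> x \<and> x \<le> k * (m + e)}"
  have H: "add_submonoid H"
    unfolding add_submonoid_def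
  proof (intro conjI ballI)
    show "0 \<in> H" by (auto simp: H_def)
    fix x y assume "x \<in> H" "y \<in> H"
    then obtain k l where "k * m \<le> x" "x \<le> k * (m + e)" "l * m \<le> y" "y \<le> l * (m + e)"
      by (auto simp: H_def)
    then show "x + y \<in> H" unfolding H_def
      by (intro CollectI exI[of _ "k + l"]) (simp add: distrib_right add_mono)
  qed
  have "UNIV - H \<subseteq> {..<m * m}"
  proof
    fix x assume x: "x \<in> UNIV - H"
    have "x < m * m"
    proof (rule ccontr)
      assume "\<not> x < m * m"
      then have "m \<le> x div m" using assms by (simp add: less_eq_div_iff_mult_less_eq)
      moreover have "m \<le> m * e" using assms(1) by simp
      ultimately have "m \<le> (x div m) * e" using mult_le_mono1[of m "x div m" e] by linarith
      moreover have "x mod m < m" using assms by simp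
      ultimately have "(x div m) * m + x mod m \<le> (x div m) * (m + e)" by (simp only: distrib_left)
      then have "x \<le> (x div m) * (m + e)" by (simp only: div_mult_mod_eq)
      moreover have "(x div m) * m \<le> x" by simp
      ultimately have "x \<in> H" unfolding H_def by blast
      then show False using x by simp
    qed
    then show "x \<in> {..<m * m}" by simp
  qed
  then have num: "numerical_monoid H" using H finite_subset unfolding numerical_monoid_def by blast
  have ge_m: "m \<le> x" if "x \<in> H" "x \<noteq> 0" for x
  proof -
    obtain k where k: "k * m \<le> x" "x \<le> k * (m + e)" using \<open>x \<in> H\<close> unfolding H_def by blast
    then have "1 \<le> k" using that(2) by (cases k) auto
    then have "1 * m \<le> k * m" by (rule mult_le_mono1)
    then show ?thesis using k(1) by linarith
  qed
  have "atoms H = {m..m + e}"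
  proof
    show "{m..m + e} \<subseteq> atoms H"
    proof
      fix x assume x: "x \<in> {m..m + e}"
      then have "x \<in> H" unfolding H_def by (intro CollectI exI[of _ 1]) simp
      moreover have "y = 0 \<or> z = 0" if "y \<in> H" "z \<in> H" "x = y + z" for y z
      proof (rule ccontr)
        assume "\<not> (y = 0 \<or> z = 0)"
        then have "m \<le> y" "m \<le> z" using ge_m that by auto
        then show False using that x assms by simp
      qed
      ultimately show "x \<in> atoms H" using x assms unfolding atoms_def by auto
    qed
    show "atoms H \<subseteq> {m..m + e}"
    proof
      fix x assume x: "x \<in> atoms H"
      then obtain k where k: "k * m \<le> x" "x \<le> k * (m + e)" "x \<noteq> 0" by (auto simp: atoms_def H_def)
      then obtain l where l: "k = Suc l" by (cases k) auto
      have irred: "y = 0 \<or> z = 0" if "y \<in> H" "z \<in> H" "x = y + z" for y z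
        using x that unfolding atoms_def by blast
      have "l = 0"
      proof (rule ccontr)
        assume "l \<noteq> 0"
        \<comment> \<open>The largest generator that can be split off while leaving at least
          \<open>l * m\<close> for the other \<open>l\<close> summands.\<close>
        define y where "y = min (m + e) (x - l * m)"
        have y: "m \<le> y" "y \<le> m + e" "y \<le> x - l * m"
          using k l by (auto simp: y_def)
        have "y \<in> H" unfolding H_def using y by (intro CollectI exI[of _ 1]) simp
        moreover have "x - y \<le> l * (m + e)" "l * m \<le> x - y"
          using k l y unfolding y_def by (auto simp: min_def algebra_simps)
        then have "x - y \<in> H" unfolding H_def by blast
        moreover have "x = y + (x - y)" using y by simp
        ultimately have "y = 0 \<or> x - y = 0" by (rule irred)
        moreover have "l * m > 0" using \<open>l \<noteq> 0\<close> assms by simp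
        ultimately show False using \<open>l * m \<le> x - y\<close> y(1) assms by linarith
      qed
      then show "x \<in> {m..m + e}" using k l by simp
    qed
  qed
  then have "min_gens H = {m..m + e}" using min_gens_eq_atoms[OF H] by simp
  then have "nm_edim H = e + 1" "nm_mult H = m"
    by (auto simp: nm_edim_def nm_mult_def intro!: Min_eqI)
  then show ?thesis using num by blast
qed

section \<open>Macaulay expansions\<close>

lemma macaulay_expansion_step:
  assumes "macaulay_expansion x (Suc d) j f" "j \<le> d"
  shows "macaulay_expansion (x - (f (Suc d) choose Suc d)) d j f"
    and "x = (\<Sum>i=j..d. f i choose i) + (f (Suc d) choose Suc d)"
  using assms by (auto simp: macaulay_expansion_def strict_mono_on_def)

lemma macaulay_expansion_pos:
  assumes "macaulay_expansion x d j f"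
  shows "0 < x"
proof -
  have j: "j \<le> d" "j \<le> f j" and x: "x = (\<Sum>i=j..d. f i choose i)"
    using assms unfolding macaulay_expansion_def by blast+
  show ?thesis unfolding x using j by (intro sum_pos2[of _ j]) auto
qed

text \<open>Strict growth of \<open>f\<close> bounds the lower terms by C(f(d+1), d), and Pascal's
  rule absorbs them. Together with \<open>macaulay_expansion_top\<close> this forces the top entry
  to be the greedy one.\<close>

lemma macaulay_expansion_less:
  assumes "macaulay_expansion x d j f"
  shows "x < (f d + 1) choose d"
  using assms
proof (induction d arbitrary: x)
  case 0
  then show ?case by (auto simp: macaulay_expansion_def)
next
  case (Suc d)
  show ?case
  proof (cases "j \<le> d")
    case True
    note step = macaulay_expansion_step[OF Suc.prems True]
    have "f d < f (Suc d)"
      using Suc.prems True by (auto simp: macaulay_expansion_def strict_mono_on_def)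
    then have "(f d + 1) choose d \<le> f (Suc d) choose d" by (intro binomial_right_mono) simp
    then show ?thesis using Suc.IH[OF step(1)] step(2) by simp
  next
    case False
    then have "j = Suc d" using Suc.prems by (simp add: macaulay_expansion_def)
    then have "x = f (Suc d) choose Suc d" "d \<le> f (Suc d)" using Suc.prems
      by (auto simp: macaulay_expansion_def)
    then show ?thesis by simp
  qed
qed

lemma macaulay_expansion_top:
  assumes "macaulay_expansion x d j f"
  shows "f d choose d \<le> x"
  using assms member_le_sum[of d "{j..d}" "\<lambda>i. f i choose i"] by (auto simp: macaulay_expansion_def)

text \<open>The values of \<open>f\<close> off \<open>{j..d}\<close> are arbitrary, so uniqueness is
  stated for the shifted sum that \<open>macaulay_up\<close> describes.\<close>

lemma macaulay_expansion_unique: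
  assumes "macaulay_expansion x d j f" "macaulay_expansion x d j' f'"
  shows "(\<Sum>i=j..d. (f i + 1) choose (i + 1)) = (\<Sum>i=j'..d. (f' i + 1) choose (i + 1))"
  using assms
proof (induction d arbitrary: x)
  case 0
  then show ?case by (auto simp: macaulay_expansion_def)
next
  case (Suc d)
  have "f (Suc d) = f' (Suc d)"
  proof (rule ccontr)
    assume "f (Suc d) \<noteq> f' (Suc d)"
    then have "f (Suc d) + 1 \<le> f' (Suc d) \<or> f' (Suc d) + 1 \<le> f (Suc d)" by linarith
    then show False
      using macaulay_expansion_less[OF Suc.prems(1)] macaulay_expansion_top[OF Suc.prems(1)]
        macaulay_expansion_less[OF Suc.prems(2)] macaulay_expansion_top[OF Suc.prems(2)]
        binomial_right_mono[of "f (Suc d) + 1" "f' (Suc d)" "Suc d"]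
        binomial_right_mono[of "f' (Suc d) + 1" "f (Suc d)" "Suc d"]
      by linarith
  qed
  note top = this
  have last: "x - (f (Suc d) choose Suc d) = 0"
    if "macaulay_expansion x (Suc d) k h" "\<not> k \<le> d" "h (Suc d) = f (Suc d)" for k h
    using that le_antisym[of k "Suc d"] by (auto simp: macaulay_expansion_def not_le Suc_le_eq)
  show ?case
  proof (cases "x - (f (Suc d) choose Suc d) = 0")
    case True
    then have "\<not> j \<le> d" "\<not> j' \<le> d"
      using macaulay_expansion_pos macaulay_expansion_step(1) Suc.prems top by fastforce+
    then have "j = Suc d" "j' = Suc d" using Suc.prems by (auto simp: macaulay_expansion_def)
    then show ?thesis using top by simp
  next
    case False
    then have j: "j \<le> d" "j' \<le> d" using last[of j f] last[of j' f'] Suc.prems top by auto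
    have "(\<Sum>i=j..d. (f i + 1) choose (i + 1)) = (\<Sum>i=j'..d. (f' i + 1) choose (i + 1))"
      using Suc.IH macaulay_expansion_step(1)[OF Suc.prems(1) j(1)]
        macaulay_expansion_step(1)[OF Suc.prems(2) j(2)] top by simp
    then show ?thesis using j top by simp
  qed
qed

lemma less_binomial_add:
  assumes "0 < d"
  shows "x < (x + d) choose d"
proof (induction x)
  case (Suc x)
  obtain c where c: "d = Suc c" using assms by (cases d) auto
  have "0 < (x + d) choose c" using c by simp
  moreover have "(Suc x + d) choose d = ((x + d) choose c) + ((x + d) choose d)"
    unfolding c by (simp only: add_Suc binomial_Suc_Suc)
  ultimately show ?case using Suc.IH by linarith
qed simp

lemma ex_binomial_bracket:
  assumes "0 < d" "0 < (x::nat)"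
  obtains a where "a choose d \<le> x" "x < (a + 1) choose d"
proof -
  have "x < (x + d) choose d" using assms(1) by (rule less_binomial_add)
  then have ex: "\<exists>a. x < a choose d" by blast
  define a where "a = (LEAST a. x < a choose d)"
  have a: "x < a choose d" using ex unfolding a_def by (rule LeastI_ex)
  have "a \<noteq> 0" using a assms by (cases d) (auto intro: ccontr)
  then obtain b where b: "a = Suc b" by (cases a) auto
  have "\<not> x < b choose d" using not_less_Least[of b "\<lambda>a. x < a choose d"] b unfolding a_def by simp
  then show thesis using that[of b] a b by simp
qed

text \<open>Greedy choice: for the largest \<open>a\<close> with C(a, d) \<le> x, Pascal's rule
  bounds the remainder below C(a, d-1), so the next entry is smaller than \<open>a\<close>.\<close>

lemma macaulay_expansion_exists:
  assumes "0 < x" "0 < d"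
  shows "\<exists>j f. macaulay_expansion x d j f"
  using assms
proof (induction d arbitrary: x)
  case 0
  then show ?case by simp
next
  case (Suc d)
  obtain a where a: "a choose Suc d \<le> x" "x < (a + 1) choose Suc d"
    using ex_binomial_bracket[of "Suc d" x] Suc.prems by blast
  have ad: "Suc d \<le> a"
  proof (rule ccontr)
    assume "\<not> Suc d \<le> a"
    then have "(a + 1) choose Suc d \<le> Suc d choose Suc d" by (intro binomial_right_mono) simp
    then show False using a(2) Suc.prems by simp
  qed
  define y where "y = x - (a choose Suc d)"
  have y: "x = y + (a choose Suc d)" "y < a choose d" using a by (auto simp: y_def)
  show ?case
  proof (cases "y = 0")
    case True
    then have "macaulay_expansion x (Suc d) (Suc d) (\<lambda>_. a)"
      using ad y by (auto simp: macaulay_expansion_def strict_mono_on_def)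
    then show ?thesis by blast
  next
    case False
    have "d \<noteq> 0" using False y by (cases d) auto
    then obtain j f where f: "macaulay_expansion y d j f" using Suc.IH[of y] False by auto
    have fd: "f d < a"
    proof (rule ccontr)
      assume "\<not> f d < a"
      then have "a choose d \<le> f d choose d" by (intro binomial_right_mono) simp
      then show False using macaulay_expansion_top[OF f] y by simp
    qed
    define h where "h = f(Suc d := a)"
    have j: "1 \<le> j" "j \<le> d" "j \<le> f j"
      and mono: "strict_mono_on {j..d} f" and ysum: "y = (\<Sum>i=j..d. f i choose i)"
      using f by (auto simp: macaulay_expansion_def)
    have "h i < h k" if "i \<in> {j..Suc d}" "k \<in> {j..Suc d}" "i < k" for i k
    proof (cases "k = Suc d")
      case True
      have "f i \<le> f d" using that True mono unfolding strict_mono_on_def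
        by (cases "i = d") (auto intro: less_imp_le)
      then show ?thesis using True that fd by (simp add: h_def)
    next
      case False
      then show ?thesis using that mono unfolding strict_mono_on_def h_def by auto
    qed
    then have "strict_mono_on {j..Suc d} h" by (auto simp: strict_mono_on_def)
    moreover have "x = (\<Sum>i=j..Suc d. h i choose i)" using j y ysum by (simp add: h_def)
    ultimately have "macaulay_expansion x (Suc d) j h"
      using j by (simp add: macaulay_expansion_def h_def)
    then show ?thesis by blast
  qed
qed

lemma macaulay_up_ge:
  assumes "0 < d"
  shows "x \<le> macaulay_up x d"
proof (cases "x = 0")
  case False
  then obtain j f where f: "macaulay_expansion x d j f"
    using macaulay_expansion_exists assms by blast
  have "macaulay_up x d = (THE k. \<exists>j f. macaulay_expansion x d j f \<and> k = (\<Sum>i=j..d. (f i + 1) choose (i + 1)))"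
    using False by (simp add: macaulay_up_def)
  also have "\<dots> = (\<Sum>i=j..d. (f i + 1) choose (i + 1))"
    using f macaulay_expansion_unique by (intro the_equality) blast+
  finally have "macaulay_up x d = (\<Sum>i=j..d. (f i + 1) choose (i + 1))" .
  moreover have "(\<Sum>i=j..d. f i choose i) \<le> (\<Sum>i=j..d. (f i + 1) choose (i + 1))"
    by (intro sum_mono) simp
  ultimately show ?thesis using f by (simp add: macaulay_expansion_def)
qed simp

lemma macaulay_index_properties:
  assumes "0 < e" "0 < m"
  shows "1 \<le> macaulay_index e m" "(e + macaulay_index e m - 1) choose (macaulay_index e m - 1) \<le> m"
    "m < (e + macaulay_index e m) choose (macaulay_index e m)"
proof -
  define P where "P r \<longleftrightarrow> 1 \<le> r \<and> (e + r - 1) choose (r - 1) \<le> m \<and> m < (e + r) choose r" for r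
  define c where "c r = (e + r) choose r" for r
  have symm: "c r = (e + r) choose e" for r using binomial_symmetric[of r "e + r"]
    by (simp add: c_def)
  have mono: "c r \<le> c t" if "r \<le> t" for r t using that unfolding symm
    by (intro binomial_right_mono) simp
  have PI: "P r \<longleftrightarrow> 1 \<le> r \<and> c (r - 1) \<le> m \<and> m < c r" for r
    by (cases r) (auto simp: P_def c_def)
  have uniq: "r = t" if "P r" "P t" for r t
  proof (rule ccontr)
    assume "r \<noteq> t"
    then have "r \<le> t - 1 \<or> t \<le> r - 1" using that by (auto simp: PI)
    then show False using that mono[of r "t - 1"] mono[of t "r - 1"] unfolding PI by linarith
  qed
  have "m < c m" using less_binomial_add[OF assms(1), of m] by (simp add: symm add.commute)
  then have ex: "\<exists>r. m < c r" by blast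
  define r where "r = (LEAST r. m < c r)"
  have r: "m < c r" using ex unfolding r_def by (rule LeastI_ex)
  have "r \<noteq> 0" using r assms by (cases r) (auto simp: c_def)
  moreover have "\<not> m < c (r - 1)"
    using not_less_Least[of "r - 1" "\<lambda>r. m < c r"] \<open>r \<noteq> 0\<close> unfolding r_def by simp
  ultimately have "P r" using r by (simp add: PI)
  then have "\<exists>!r. P r" using uniq by blast
  then have "P (THE r. P r)" by (rule theI')
  moreover have "macaulay_index e m = (THE r. P r)" by (simp add: macaulay_index_def P_def)
  ultimately have "P (macaulay_index e m)" by simp
  then show "1 \<le> macaulay_index e m"
    "(e + macaulay_index e m - 1) choose (macaulay_index e m - 1) \<le> m"
    "m < (e + macaulay_index e m) choose (macaulay_index e m)"
    by (auto simp: P_def)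
qed

section \<open>The strict inequality\<close>

lemma num_min_relations_less:
  assumes \<Gamma>: "numerical_monoid \<Gamma>" "nm_edim \<Gamma> = e + 1" "nm_mult \<Gamma> = m"
    and "e \<ge> 2"
    and q: "q > 0" "(8 * (q + 1)) ^ e \<le> (8 * q) ^ e + q ^ e"
    and v: "fact e * (8 * (q + 1)) ^ e < (r + e) div (8 * (q + 1)) + 1"
    and r: "r > 0" and m: "(e + r - 1) choose (r - 1) \<le> m" "m < (e + r) choose r"
  shows "num_min_relations \<Gamma> < (e + r - 1) choose r"
proof -
  have mon: "add_submonoid \<Gamma>" using \<Gamma>(1) by (simp add: numerical_monoid_def)
  interpret positive_weights "nm_edim \<Gamma>" "gen \<Gamma>"
    using gen_properties(2)[OF mon, of e] \<Gamma>(2) by unfold_locales auto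
  have n: "0 < nm_edim \<Gamma>" using \<Gamma>(2) by simp
  have g0: "gen \<Gamma> 0 = m" using gen_properties(1)[OF mon, of e] \<Gamma>(2,3) by simp
  have ker: "fact_ker \<Gamma> = ker" by (simp add: fact_ker_def ker_def fact_hom_def val_def)
  obtain T where T: "vec_congruence (nm_edim \<Gamma>) hull T = ker" "finite T"
    "card T \<le> card (corners {0<..<nm_edim \<Gamma>} staircase)"
    using corners_generate_ker[OF n] by blast
  have "minimal_presentation \<Gamma> (SOME S. minimal_presentation \<Gamma> S)"
    using ex_irredundant_generators[OF T(1,2)]
    unfolding minimal_presentation_def ker by (rule someI_ex)
  then have "num_min_relations \<Gamma> \<le> card T"
    unfolding num_min_relations_def minimal_presentation_def ker
    by (intro card_irredundant_generators_le[OF _ _ T(1,2)]) blast+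
  also note T(3)
  also have "card (corners {0<..<nm_edim \<Gamma>} staircase) < (e + r - 1) choose r"
  proof (rule card_corners_less[OF _ _ \<open>e \<ge> 2\<close> q refl v r m])
    have "(\<Sum>l\<in>{0<..<nm_edim \<Gamma>}. a l * gen \<Gamma> l) = val a" if "a \<in> staircase" for a
    proof -
      have "a 0 = 0" using that by (simp add: staircase_def base_iff)
      then show ?thesis unfolding val_def by (intro sum.mono_neutral_left) auto
    qed
    then show "inj_on (\<lambda>a. (\<Sum>l\<in>{0<..<nm_edim \<Gamma>}. a l * gen \<Gamma> l) mod m) staircase"
      using inj_on_staircase by (simp add: g0 inj_on_def)
    show "staircase \<subseteq> vecs {0<..<nm_edim \<Gamma>}" unfolding staircase_def by blast
  qed (use \<Gamma>(2) finite_staircase[OF n] g0 zero_in_staircase staircase_down in auto)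
  finally show ?thesis .
qed

theorem theorem4p4:
  fixes e :: nat
  assumes "e \<ge> 3"
  shows "\<exists>M::nat. \<forall>m\<ge>M. int (max_relations e m) < relation_bound e m"
proof -
  obtain q :: nat where q: "q \<ge> 1" "(8 * (q + 1)) ^ e \<le> (8 * q) ^ e + q ^ e"
    using ex_ratio_near_one by blast
  define A where "A = 8 * (q + 1)"
  \<comment> \<open>For \<open>r \<ge> R\<close> the quotient \<open>(r + e) div A\<close> is at
    least \<open>fact e * A ^ e\<close>, as the gain estimate requires.\<close>
  define R where "R = A * (fact e * A ^ e)"
  \<comment> \<open>The binomial coefficient forces \<open>r \<ge> R\<close>; the summand
    \<open>e + 1\<close> gives \<open>e < m\<close>, so that a monoid with these parameters
    exists.\<close>
  have "int (max_relations e m) < relation_bound e m" if "m \<ge> ((e + R) choose R) + e + 1" for m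
  proof -
    define r where "r = macaulay_index e m"
    define s where "s = m - ((e + r - 1) choose (r - 1))"
    have "m > 0" "e > 0" using that assms by auto
    note r = macaulay_index_properties[OF \<open>e > 0\<close> \<open>m > 0\<close>, folded r_def]
    have "R \<le> r"
    proof (rule ccontr)
      assume "\<not> R \<le> r"
      then have "(e + r) choose e \<le> (e + R) choose e" by (intro binomial_right_mono) simp
      then have "(e + r) choose r \<le> (e + R) choose R"
        using binomial_symmetric[of r "e + r"] binomial_symmetric[of R "e + R"] by simp
      then show False using r(3) that by linarith
    qed
    then have "R div A \<le> (r + e) div A" by (intro div_le_mono) simp
    then have v: "fact e * A ^ e < (r + e) div A + 1" by (simp add: R_def A_def del: fact_nonzero)
    let ?V = "{num_min_relations \<Gamma> | \<Gamma>. numerical_monoid \<Gamma> \<and> nm_edim \<Gamma> = e + 1 \<and> nm_mult \<Gamma> = m}"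
    have "num_min_relations \<Gamma> < (e + r - 1) choose r"
      if "numerical_monoid \<Gamma>" "nm_edim \<Gamma> = e + 1" "nm_mult \<Gamma> = m" for \<Gamma>
      using num_min_relations_less[of \<Gamma> e m q r] that assms q v r unfolding A_def by simp
    then have bound: "?V \<subseteq> {..<(e + r - 1) choose r}" by blast
    moreover have "?V \<noteq> {}" using ex_numerical_monoid[OF \<open>e > 0\<close>, of m] that by auto
    ultimately have "max_relations e m < (e + r - 1) choose r"
      unfolding max_relations_def using finite_subset[OF bound] by (subst Max_less_iff) auto
    moreover have "s \<le> macaulay_up s r" using r(1) by (intro macaulay_up_ge) simp
    moreover have "relation_bound e m = int ((e + r - 1) choose r) + int (macaulay_up s r) - int s"
      by (simp add: relation_bound_def Let_def r_def s_def)
    ultimately show ?thesis by linarith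
  qed
  then show ?thesis by blast
qed

end
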